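(* Let $G$ be a profinite subgroup of $S_\infty$ with orbit independence. Then the full first-order theory of $G$ in the language of groups is $\Delta^0_2$ relative to $\deg(T_G)$.
   Context: $S_\infty$ is the group of all permutations of $\mathbb{N}$, with the topology of pointwise convergence; its profinite subgroups are exactly the closed subgroups all of whose orbits $\mathrm{orb}_G(n)=\{g(n):g\in G\}$ are finite. For a subgroup $G\le S_\infty$, $T_G\subseteq\mathbb{N}^{<\omega}$ is the tree of all strings of the form $g(0)g^{-1}(0)g(1)g^{-1}(1)\cdots g(n)g^{-1}(n)$ with $g\in G$, $n\in\mathbb{N}$. $\deg(T_G)$ is the Turing join of the degree of the set $T_G$ (under a fixed computable coding of $\mathbb{N}^{<\omega}$ with decidable immediate-predecessor relation) and the degree of the branching function giving the number of immediate successors of each node of $T_G$. The orbits of a profinite $G$ are enumerated as $O_{G,0}=\mathrm{orb}_G(0)$ and $O_{G,n+1}=$ the orbit of the least natural number not in any $O_{G,m}$, $m\le n$. $H_k=\{g\restriction O_{G,k}:g\in G\}$. $G$ has orbit independence if $G$ is isomorphic to $\prod_{k\in\mathbb{N}}H_k$. *)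

theory Defs
  imports
    "HOL-Library.Nat_Bijection"
    "HOL-Library.Sublist"
    "HOL-Algebra.Bij"
    "HOL-Algebra.Product_Groups"
    "HOL-Analysis.Function_Topology"
begin

section \<open>Computability relative to an oracle\<close>

text \<open>Total functions of arity \<open>n\<close> are represented on lists of length \<open>n\<close>. The total functions
  recursive in \<open>h\<close> form the least class that contains the initial functions and \<open>h\<close> and is closed
  under composition, primitive recursion and minimization of regular functions. The last rule makes
  the values on lists of the wrong length irrelevant.\<close>

inductive recursive_in :: "(nat \<Rightarrow> nat) \<Rightarrow> nat \<Rightarrow> (nat list \<Rightarrow> nat) \<Rightarrow> bool"
  for h :: "nat \<Rightarrow> nat" where
  zero: "recursive_in h n (\<lambda>_. 0)"
| succ: "recursive_in h 1 (\<lambda>xs. Suc (xs ! 0))"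
| proj: "i < n \<Longrightarrow> recursive_in h n (\<lambda>xs. xs ! i)"
| orac: "recursive_in h 1 (\<lambda>xs. h (xs ! 0))"
| comp: "recursive_in h (length gs) f \<Longrightarrow> (\<And>g. g \<in> set gs \<Longrightarrow> recursive_in h n g) \<Longrightarrow>
    recursive_in h n (\<lambda>xs. f (map (\<lambda>g. g xs) gs))"
| prec: "recursive_in h n f \<Longrightarrow> recursive_in h (n + 2) g \<Longrightarrow>
    recursive_in h (Suc n)
      (\<lambda>xs. rec_nat (f (tl xs)) (\<lambda>y r. g (y # r # tl xs)) (hd xs))"
| mini: "recursive_in h (Suc n) f \<Longrightarrow> (\<And>xs. length xs = n \<Longrightarrow> \<exists>y. f (y # xs) = 0) \<Longrightarrow>
    recursive_in h n (\<lambda>xs. LEAST y. f (y # xs) = 0)"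
| cong: "recursive_in h n f \<Longrightarrow> (\<And>xs. length xs = n \<Longrightarrow> f xs = f' xs) \<Longrightarrow> recursive_in h n f'"

definition decidable_in :: "(nat \<Rightarrow> nat) \<Rightarrow> nat \<Rightarrow> (nat list \<Rightarrow> bool) \<Rightarrow> bool" where
  "decidable_in h n R \<longleftrightarrow> recursive_in h n (\<lambda>xs. if R xs then 1 else 0)"

definition Sigma02_in :: "(nat \<Rightarrow> nat) \<Rightarrow> nat set \<Rightarrow> bool" where
  "Sigma02_in h A \<longleftrightarrow>
     (\<exists>R. decidable_in h 3 R \<and> (\<forall>n. n \<in> A \<longleftrightarrow> (\<exists>x. \<forall>y. R [n, x, y])))"

definition Pi02_in :: "(nat \<Rightarrow> nat) \<Rightarrow> nat set \<Rightarrow> bool" where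
  "Pi02_in h A \<longleftrightarrow>
     (\<exists>R. decidable_in h 3 R \<and> (\<forall>n. n \<in> A \<longleftrightarrow> (\<forall>x. \<exists>y. R [n, x, y])))"

definition Delta02_in :: "(nat \<Rightarrow> nat) \<Rightarrow> nat set \<Rightarrow> bool" where
  "Delta02_in h A \<longleftrightarrow> Sigma02_in h A \<and> Pi02_in h A"

definition turing_le :: "(nat \<Rightarrow> nat) \<Rightarrow> (nat \<Rightarrow> nat) \<Rightarrow> bool" where
  "turing_le f h \<longleftrightarrow> recursive_in h 1 (\<lambda>xs. f (xs ! 0))"

definition turing_degree :: "(nat \<Rightarrow> nat) \<Rightarrow> (nat \<Rightarrow> nat) set" where
  "turing_degree f = {h. turing_le h f \<and> turing_le f h}"

definition char_fun :: "nat set \<Rightarrow> nat \<Rightarrow> nat" where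
  "char_fun A n = (if n \<in> A then 1 else 0)"

definition join_fun :: "(nat \<Rightarrow> nat) \<Rightarrow> (nat \<Rightarrow> nat) \<Rightarrow> nat \<Rightarrow> nat" where
  "join_fun f g n = (if even n then f (n div 2) else g (n div 2))"

definition degree_join ::
    "(nat \<Rightarrow> nat) set \<Rightarrow> (nat \<Rightarrow> nat) set \<Rightarrow> (nat \<Rightarrow> nat) set" where
  "degree_join a b = (\<Union>f\<in>a. \<Union>g\<in>b. turing_degree (join_fun f g))"

definition Delta02_rel_degree :: "(nat \<Rightarrow> nat) set \<Rightarrow> nat set \<Rightarrow> bool" where
  "Delta02_rel_degree d A \<longleftrightarrow> (\<forall>h\<in>d. Delta02_in h A)"

lemma turing_degree_self: "f \<in> turing_degree f"
  unfolding turing_degree_def turing_le_def using recursive_in.orac by blast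

lemma join_fun_in_degree_join:
  "join_fun f g \<in> degree_join (turing_degree f) (turing_degree g)"
  unfolding degree_join_def using turing_degree_self by blast


section \<open>First-order theories in the language of groups\<close>

datatype gterm = TVar nat | TOne | TMult gterm gterm | TInv gterm

datatype gform = FEq gterm gterm | FNeg gform | FConj gform gform | FEx nat gform

fun tvars :: "gterm \<Rightarrow> nat set" where
  "tvars (TVar n) = {n}"
| "tvars TOne = {}"
| "tvars (TMult s t) = tvars s \<union> tvars t"
| "tvars (TInv t) = tvars t"

fun free_vars :: "gform \<Rightarrow> nat set" where
  "free_vars (FEq s t) = tvars s \<union> tvars t"
| "free_vars (FNeg \<phi>) = free_vars \<phi>"
| "free_vars (FConj \<phi> \<psi>) = free_vars \<phi> \<union> free_vars \<psi>"
| "free_vars (FEx n \<phi>) = free_vars \<phi> - {n}"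

definition sentence :: "gform \<Rightarrow> bool" where
  "sentence \<phi> \<longleftrightarrow> free_vars \<phi> = {}"

fun tval :: "('a, 'b) monoid_scheme \<Rightarrow> (nat \<Rightarrow> 'a) \<Rightarrow> gterm \<Rightarrow> 'a" where
  "tval M e (TVar n) = e n"
| "tval M e TOne = \<one>\<^bsub>M\<^esub>"
| "tval M e (TMult s t) = tval M e s \<otimes>\<^bsub>M\<^esub> tval M e t"
| "tval M e (TInv t) = inv\<^bsub>M\<^esub> (tval M e t)"

fun sat :: "('a, 'b) monoid_scheme \<Rightarrow> (nat \<Rightarrow> 'a) \<Rightarrow> gform \<Rightarrow> bool" where
  "sat M e (FEq s t) \<longleftrightarrow> tval M e s = tval M e t"
| "sat M e (FNeg \<phi>) \<longleftrightarrow> \<not> sat M e \<phi>"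
| "sat M e (FConj \<phi> \<psi>) \<longleftrightarrow> sat M e \<phi> \<and> sat M e \<psi>"
| "sat M e (FEx n \<phi>) \<longleftrightarrow> (\<exists>a\<in>carrier M. sat M (e(n := a)) \<phi>)"

definition group_theory :: "('a, 'b) monoid_scheme \<Rightarrow> gform set" where
  "group_theory M = {\<phi>. sentence \<phi> \<and> (\<forall>e. range e \<subseteq> carrier M \<longrightarrow> sat M e \<phi>)}"

fun tcode :: "gterm \<Rightarrow> nat" where
  "tcode (TVar n) = prod_encode (0, n)"
| "tcode TOne = prod_encode (1, 0)"
| "tcode (TMult s t) = prod_encode (2, prod_encode (tcode s, tcode t))"
| "tcode (TInv t) = prod_encode (3, tcode t)"

fun fcode :: "gform \<Rightarrow> nat" where
  "fcode (FEq s t) = prod_encode (0, prod_encode (tcode s, tcode t))"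
| "fcode (FNeg \<phi>) = prod_encode (1, fcode \<phi>)"
| "fcode (FConj \<phi> \<psi>) = prod_encode (2, prod_encode (fcode \<phi>, fcode \<psi>))"
| "fcode (FEx n \<phi>) = prod_encode (3, prod_encode (n, fcode \<phi>))"


section \<open>Profinite subgroups of the group of permutations of the natural numbers\<close>

abbreviation S_infinity :: "(nat \<Rightarrow> nat) monoid" where
  "S_infinity \<equiv> BijGroup UNIV"

definition as_group :: "(nat \<Rightarrow> nat) set \<Rightarrow> (nat \<Rightarrow> nat) monoid" where
  "as_group G = S_infinity\<lparr>carrier := G\<rparr>"

definition orb :: "(nat \<Rightarrow> nat) set \<Rightarrow> nat \<Rightarrow> nat set" where
  "orb G n = {g n | g. g \<in> G}"

text \<open>The topology on \<^typ>\<open>nat \<Rightarrow> nat\<close> is the product of the discrete topologies, i.e. that of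
  pointwise convergence.\<close>

definition profinite_subgroup :: "(nat \<Rightarrow> nat) set \<Rightarrow> bool" where
  "profinite_subgroup G \<longleftrightarrow>
     subgroup G S_infinity \<and> closedin (top_of_set (carrier S_infinity)) G \<and>
     (\<forall>n. finite (orb G n))"

fun orbit_enum :: "(nat \<Rightarrow> nat) set \<Rightarrow> nat \<Rightarrow> nat set" where
  "orbit_enum G 0 = orb G 0"
| "orbit_enum G (Suc n) = orb G (LEAST x. \<forall>m\<in>{..n}. x \<notin> orbit_enum G m)"

definition orbit_restriction :: "(nat \<Rightarrow> nat) set \<Rightarrow> nat \<Rightarrow> (nat \<Rightarrow> nat) monoid" where
  "orbit_restriction G k =
     (BijGroup (orbit_enum G k))\<lparr>carrier := {restrict g (orbit_enum G k) | g. g \<in> G}\<rparr>"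

definition orbit_independent :: "(nat \<Rightarrow> nat) set \<Rightarrow> bool" where
  "orbit_independent G \<longleftrightarrow> as_group G \<cong> product_group UNIV (orbit_restriction G)"


section \<open>The tree of a permutation group and its degree\<close>

definition perm_string :: "(nat \<Rightarrow> nat) \<Rightarrow> nat \<Rightarrow> nat list" where
  "perm_string g n = concat (map (\<lambda>i. [g i, inv_into UNIV g i]) [0..<Suc n])"

definition perm_tree :: "(nat \<Rightarrow> nat) set \<Rightarrow> nat list set" where
  "perm_tree G = {perm_string g n | g n. g \<in> G}"

text \<open>All strings in \<^const>\<open>perm_tree\<close> have even length, so immediate successors are taken with
  respect to the extension order on the tree itself.\<close>

definition immediate_succs :: "nat list set \<Rightarrow> nat list \<Rightarrow> nat list set" where
  "immediate_succs T \<sigma> =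
     {\<tau>\<in>T. strict_prefix \<sigma> \<tau> \<and> \<not> (\<exists>\<rho>\<in>T. strict_prefix \<sigma> \<rho> \<and> strict_prefix \<rho> \<tau>)}"

text \<open>Codes of strings outside the tree get the value 0.\<close>

definition branching_fun :: "nat list set \<Rightarrow> nat \<Rightarrow> nat" where
  "branching_fun T c =
     (if list_decode c \<in> T then card (immediate_succs T (list_decode c)) else 0)"

definition tree_degree :: "nat list set \<Rightarrow> (nat \<Rightarrow> nat) set" where
  "tree_degree T =
     degree_join (turing_degree (char_fun (list_encode ` T))) (turing_degree (branching_fun T))"

end

theory Submission imports Defs begin

text \<open>The theory of \<open>G\<close> is that of the product of all the finite groups \<open>H\<^sub>k\<close>. By an
  Ehrenfeucht--Fraisse (Feferman--Vaught) argument the truth of a sentence in a product depends only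
  on how many factors have each of finitely many colours, counted up to a threshold. These counts,
  and hence the truth value, are the same for the infinite product and for all sufficiently long
  finite subproducts. The finite subproducts are uniformly computable from the tree and its branching
  function: each level of the tree can be listed, and the levels determine the orbits and the groups
  \<open>H\<^sub>k\<close>. So the theory is the pointwise limit of a sequence of sets decidable in \<open>deg(T\<^sub>G)\<close>.\<close>

section \<open>Relative computability on coded types\<close>

text \<open>Only a limit is reached because no stage can be certified: finitely many factors do not
  settle how large a colour class of the whole product is. So a stage of agreement is only shown to
  exist, for each sentence separately, and the decision procedure itself never sees colours or
  thresholds; it evaluates the sentence in a finite group. The bounds on the counts grow with the
  quantifiers: from \<open>B\<close> colours and threshold \<open>c\<close>, one existential
  quantifier leads to \<open>2 ^ B\<close> colours (sets of old colours) and threshold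
  \<open>c * B\<close> (pigeonhole). A colour is a function of an arbitrary group with an
  environment, so the same colours apply to both products compared. Orbits are indexed by their
  least elements instead of by position in the enumeration; this makes being an index decidable and
  the stage a bound on indices. Two obstacles shape the coding: a level of the tree shows
  \<open>g\<close> on an initial segment only, while an orbit may reach beyond it; and evaluation
  recurses on a code with changing environments, so well-founded recursion is obtained by searching
  for tables of values.\<close>

lemma recursive_in_comp1:
  assumes "recursive_in h 1 (\<lambda>xs. F (xs ! 0))" "recursive_in h n g"
  shows "recursive_in h n (\<lambda>xs. F (g xs))"
  using recursive_in.comp[of h "[g]" "\<lambda>xs. F (xs ! 0)" n] assms by simp

lemma recursive_in_comp2:
  assumes "recursive_in h 2 (\<lambda>xs. F (xs ! 0) (xs ! 1))" "recursive_in h n g1" "recursive_in h n g2"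
  shows "recursive_in h n (\<lambda>xs. F (g1 xs) (g2 xs))"
  using recursive_in.comp[of h "[g1, g2]" "\<lambda>xs. F (xs ! 0) (xs ! 1)" n] assms
  by (auto simp: numeral_2_eq_2)

lemma recursive_in_proj0: "recursive_in h 1 (\<lambda>xs. xs ! 0)"
  by (rule recursive_in.proj) simp

lemmas recursive_in_proj0' = recursive_in_proj0[unfolded One_nat_def]

lemma recursive_in_Suc: "recursive_in h n g \<Longrightarrow> recursive_in h n (\<lambda>xs. Suc (g xs))"
  by (rule recursive_in_comp1[OF recursive_in.succ])

lemma recursive_in_const: "recursive_in h n (\<lambda>_. c)"
  by (induction c) (auto intro: recursive_in.zero recursive_in_Suc)

text \<open>A single parameter \<open>x\<close> is enough, since every tuple of parameters can be
  coded by one number.\<close>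

lemma recursive_in_rec_nat:
  assumes f: "recursive_in h 1 (\<lambda>xs. f (xs ! 0))"
    and g: "recursive_in h 3 (\<lambda>xs. g (xs ! 0) (xs ! 1) (xs ! 2))"
    and k: "recursive_in h n k" and x: "recursive_in h n x"
  shows "recursive_in h n (\<lambda>xs. rec_nat (f (x xs)) (\<lambda>y r. g y r (x xs)) (k xs))"
proof -
  have "recursive_in h (Suc 1) (\<lambda>xs. rec_nat (f (tl xs ! 0))
      (\<lambda>y r. g ((y # r # tl xs) ! 0) ((y # r # tl xs) ! 1) ((y # r # tl xs) ! 2)) (hd xs))"
    by (rule recursive_in.prec[OF f]) (use g in \<open>simp add: numeral_3_eq_3\<close>)
  then have "recursive_in h 2 (\<lambda>xs. rec_nat (f (xs ! 1)) (\<lambda>y r. g y r (xs ! 1)) (xs ! 0))"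
    unfolding numeral_2_eq_2 One_nat_def
    by (rule recursive_in.cong) (auto simp: length_Suc_conv)
  from recursive_in_comp2[OF this k x] show ?thesis .
qed

lemma recursive_in_add:
  assumes "recursive_in h n a" "recursive_in h n b"
  shows "recursive_in h n (\<lambda>xs. a xs + b xs)"
proof -
  have "recursive_in h n (\<lambda>xs. rec_nat (a xs) (\<lambda>y r. Suc r) (b xs))"
    by (rule recursive_in_rec_nat[where g = "\<lambda>y r x. Suc r", OF recursive_in_proj0])
      (auto intro!: recursive_in_Suc recursive_in.proj assms)
  moreover have "rec_nat x (\<lambda>y r. Suc r) y = x + y" for x y :: nat
    by (induction y) auto
  ultimately show ?thesis by simp
qed

lemma recursive_in_pred:
  assumes "recursive_in h n a"
  shows "recursive_in h n (\<lambda>xs. a xs - 1)"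
proof -
  have "recursive_in h n (\<lambda>xs. rec_nat 0 (\<lambda>y r. y) (a xs))"
    by (rule recursive_in_rec_nat[where g = "\<lambda>y r x. y" and f = "\<lambda>_. 0" and x = "\<lambda>_. 0",
          OF recursive_in.zero])
      (auto intro!: recursive_in.proj recursive_in.zero assms)
  moreover have "rec_nat 0 (\<lambda>y r. y) y = y - 1" for y :: nat
    by (cases y) auto
  ultimately show ?thesis by simp
qed

lemma recursive_in_diff:
  assumes "recursive_in h n a" "recursive_in h n b"
  shows "recursive_in h n (\<lambda>xs. a xs - b xs)"
proof -
  have "recursive_in h n (\<lambda>xs. rec_nat (a xs) (\<lambda>y r. r - 1) (b xs))"
    by (rule recursive_in_rec_nat[where g = "\<lambda>y r x. r - 1", OF recursive_in_proj0])
      (auto intro!: recursive_in_pred[unfolded One_nat_def] recursive_in.proj assms)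
  moreover have "rec_nat x (\<lambda>y r. r - 1) y = x - y" for x y :: nat
    by (induction y) auto
  ultimately show ?thesis by simp
qed

lemma recursive_in_triangle:
  assumes "recursive_in h n a"
  shows "recursive_in h n (\<lambda>xs. triangle (a xs))"
proof -
  have "recursive_in h n (\<lambda>xs. rec_nat 0 (\<lambda>y r. r + Suc y) (a xs))"
    by (rule recursive_in_rec_nat[where g = "\<lambda>y r x. r + Suc y" and f = "\<lambda>_. 0" and x = "\<lambda>_. 0",
          OF recursive_in.zero])
      (intro recursive_in_add recursive_in_Suc recursive_in.proj recursive_in.zero assms; simp)+
  moreover have "rec_nat 0 (\<lambda>y r. r + Suc y) y = triangle y" for y :: nat
    by (induction y) auto
  ultimately show ?thesis by simp
qed

lemma recursive_in_prod_encode: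
  assumes "recursive_in h n a" "recursive_in h n b"
  shows "recursive_in h n (\<lambda>xs. prod_encode (a xs, b xs))"
  by (auto simp: prod_encode_def intro!: recursive_in_add recursive_in_triangle assms)

text \<open>\<open>mini\<close> asks for a regular function, so a zero must exist for every
  parameter \<open>x\<close> and not just for the values of \<open>a\<close>.\<close>

lemma recursive_in_Least:
  assumes f: "recursive_in h 2 (\<lambda>xs. f (xs ! 0) (xs ! 1))" and a: "recursive_in h n a"
    and ex: "\<And>x. \<exists>y. f y x = 0"
  shows "recursive_in h n (\<lambda>xs. LEAST y. f y (a xs) = 0)"
proof -
  have "recursive_in h 1 (\<lambda>xs. LEAST y. f ((y # xs) ! 0) ((y # xs) ! 1) = 0)"
    by (rule recursive_in.mini) (use f ex in \<open>auto simp: numeral_2_eq_2\<close>)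
  then have "recursive_in h 1 (\<lambda>xs. LEAST y. f y (xs ! 0) = 0)" by simp
  from recursive_in_comp1[OF this a] show ?thesis .
qed

text \<open>The pair with code \<open>c\<close> has sum \<open>w\<close> determined by \<open>triangle w \<le> c < triangle (Suc w)\<close>.\<close>

lemma prod_decode_eq_Least:
  fixes c :: nat
  defines "w \<equiv> (LEAST y. Suc c - triangle (Suc y) = 0)"
  shows "prod_decode c = (c - triangle w, w - (c - triangle w))"
proof -
  obtain a b where c: "c = prod_encode (a, b)"
    by (metis prod_decode_inverse surj_pair)
  have mono: "triangle x \<le> triangle y" if "x \<le> y" for x y
    using that by (induction rule: dec_induct) auto
  have "w = a + b" unfolding w_def
  proof (rule Least_equality)
    show "Suc c - triangle (Suc (a + b)) = 0" by (simp add: c prod_encode_def)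
    show "a + b \<le> y" if "Suc c - triangle (Suc y) = 0" for y
    proof (rule ccontr)
      assume "\<not> a + b \<le> y"
      then have "triangle (Suc y) \<le> triangle (a + b)" by (intro mono) auto
      with that show False by (simp add: c prod_encode_def)
    qed
  qed
  moreover have "c = triangle (a + b) + a" by (simp add: c prod_encode_def)
  moreover have "prod_decode c = (a, b)" by (simp add: c)
  ultimately show ?thesis by simp
qed

lemma recursive_in_prod_decode:
  assumes "recursive_in h n a"
  shows "recursive_in h n (\<lambda>xs. fst (prod_decode (a xs)))"
    and "recursive_in h n (\<lambda>xs. snd (prod_decode (a xs)))"
proof -
  let ?w = "\<lambda>x. LEAST y. Suc x - triangle (Suc y) = 0"
  have ex: "\<exists>y. Suc x - triangle (Suc y) = 0" for x
    by (rule exI[of _ x]) simp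
  have w: "recursive_in h n (\<lambda>xs. ?w (a xs))"
    by (rule recursive_in_Least[OF _ assms ex])
      (intro recursive_in_diff recursive_in_triangle recursive_in_Suc recursive_in.proj; simp)
  show "recursive_in h n (\<lambda>xs. fst (prod_decode (a xs)))"
    and "recursive_in h n (\<lambda>xs. snd (prod_decode (a xs)))"
    unfolding prod_decode_eq_Least fst_conv snd_conv
    by (intro recursive_in_diff recursive_in_triangle w assms)+
qed

text \<open>Induction on the derivation: only \<open>orac\<close> consults the oracle, and there the
  derivation of \<open>f\<close> from \<open>h\<close> is substituted.\<close>

lemma recursive_in_trans:
  assumes "recursive_in f n F" "turing_le f h"
  shows "recursive_in h n F"
  using assms(1)
proof induction
  case orac
  show ?case using assms(2) by (simp add: turing_le_def)
next
  case (comp gs f n)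
  show ?case by (rule recursive_in.comp; fact)
next
  case (mini n f)
  show ?case by (rule recursive_in.mini; fact)
next
  case (cong n f f')
  show ?case by (rule recursive_in.cong; fact)
next
  case (prec n f g)
  show ?case by (rule recursive_in.prec; fact)
qed (rule recursive_in.intros; assumption?)+

text \<open>Codings are bijections rather than injections: then \<open>dec\<close> is total, every
  number is a code, and an unbounded search over numbers is a search over the type. The price is
  that a coded type is infinite, so truth values get a predicate of their own,
  \<open>decides\<close>.\<close>

class coded =
  fixes enc :: "'a \<Rightarrow> nat"
  assumes bij_enc: "bij enc"
begin

definition dec :: "nat \<Rightarrow> 'a" where "dec = inv_into UNIV enc"

lemma dec_enc [simp]: "dec (enc x) = x"
  by (simp add: dec_def bij_enc bij_is_inj)

lemma enc_dec [simp]: "enc (dec n) = n"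
  by (simp add: dec_def bij_enc bij_is_surj surj_f_inv_f)

lemma enc_eq_iff [simp]: "enc x = enc y \<longleftrightarrow> x = y"
  by (metis dec_enc)

end

lemma coded_bijI:
  assumes "\<And>x. g (f x) = x" "\<And>y. f (g y) = y"
  shows "bij f"
  using assms by (metis bijI')

instantiation nat :: coded
begin
definition "enc (n::nat) = n"
instance by standard (simp add: enc_nat_def[abs_def] bij_def)
end

instantiation prod :: (coded, coded) coded
begin
definition "enc (p :: 'a \<times> 'b) = prod_encode (enc (fst p), enc (snd p))"
instance
  by standard (rule coded_bijI[where g = "\<lambda>n. (dec (fst (prod_decode n)), dec (snd (prod_decode n)))"];
      simp add: enc_prod_def)
end

instantiation list :: (coded) coded
begin
definition "enc (xs :: 'a list) = list_encode (map enc xs)"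
instance
  by standard (rule coded_bijI[where g = "\<lambda>n. map dec (list_decode n)"];
      simp add: enc_list_def o_def)
end

instantiation option :: (coded) coded
begin
definition "enc (x :: 'a option) = (case x of None \<Rightarrow> 0 | Some y \<Rightarrow> Suc (enc y))"
instance
  by standard (rule coded_bijI[where g = "\<lambda>n. case n of 0 \<Rightarrow> None | Suc m \<Rightarrow> Some (dec m)"];
      simp add: enc_option_def split: option.split nat.split)
end

lemma dec_nat [simp]: "(dec n :: nat) = n"
  using enc_dec[of n, where 'a = nat] by (simp only: enc_nat_def)

lemma enc_Pair: "enc (x, y) = prod_encode (enc x, enc y)"
  by (simp add: enc_prod_def)

lemma dec_prod: "dec n = (dec (fst (prod_decode n)), dec (snd (prod_decode n)))"
  by (rule injD[OF bij_is_inj[OF bij_enc]]) (simp add: enc_Pair)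

lemma enc_Nil: "enc [] = 0"
  by (simp add: enc_list_def)

lemma enc_Cons: "enc (x # xs) = Suc (enc (x, xs))"
  by (simp add: enc_list_def enc_Pair)

text \<open>Arity 1 suffices because pairs are coded; a function of several arguments appears in
  premises uncurried, through \<open>fst p\<close> and \<open>snd p\<close>.\<close>

definition computable :: "(nat \<Rightarrow> nat) \<Rightarrow> ('a::coded \<Rightarrow> 'b::coded) \<Rightarrow> bool" where
  "computable h f \<longleftrightarrow> recursive_in h 1 (\<lambda>xs. enc (f (dec (xs ! 0))))"

definition decides :: "(nat \<Rightarrow> nat) \<Rightarrow> ('a::coded \<Rightarrow> bool) \<Rightarrow> bool" where
  "decides h P \<longleftrightarrow> computable h (\<lambda>x. if P x then 1 else 0 :: nat)"

section \<open>Closure under composition, recursion, search and case distinction\<close>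

named_theorems computable_intros

lemma computable_const [computable_intros]: "computable h (\<lambda>_. c)"
  by (simp add: computable_def recursive_in_const)

lemma computable_id [computable_intros]: "computable h (\<lambda>x. x)"
  by (simp add: computable_def recursive_in_proj0')

lemma computable_comp:
  assumes "computable h F" "computable h f"
  shows "computable h (\<lambda>x. F (f x))"
  using recursive_in_comp1[OF assms[unfolded computable_def]]
  by (simp add: computable_def)

lemma computable_Pair [computable_intros]:
  assumes "computable h f" "computable h g"
  shows "computable h (\<lambda>x. (f x, g x))"
  using assms unfolding computable_def enc_Pair by (rule recursive_in_prod_encode)

lemma computable_fst [computable_intros]: "computable h f \<Longrightarrow> computable h (\<lambda>x. fst (f x))"
  by (erule computable_comp[rotated])
    (simp add: computable_def dec_prod recursive_in_prod_decode recursive_in_proj0')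

lemma computable_snd [computable_intros]: "computable h f \<Longrightarrow> computable h (\<lambda>x. snd (f x))"
  by (erule computable_comp[rotated])
    (simp add: computable_def dec_prod recursive_in_prod_decode recursive_in_proj0')

lemma computable_comp2:
  assumes "computable h (\<lambda>p. F (fst p) (snd p))" "computable h f" "computable h g"
  shows "computable h (\<lambda>x. F (f x) (g x))"
  using computable_comp[OF assms(1) computable_Pair[OF assms(2,3)]] by simp

lemma computable_comp3:
  assumes "computable h (\<lambda>p. F (fst p) (fst (snd p)) (snd (snd p)))"
    "computable h f" "computable h g" "computable h k"
  shows "computable h (\<lambda>x. F (f x) (g x) (k x))"
  using computable_comp[OF assms(1) computable_Pair[OF assms(2) computable_Pair[OF assms(3,4)]]]
  by simp

lemma computable_enc: "computable h enc"
  by (simp add: computable_def recursive_in_proj0' enc_nat_def)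

lemma computable_dec: "computable h dec"
  by (simp add: computable_def recursive_in_proj0')

lemmas computable_enc' [computable_intros] = computable_comp[OF computable_enc]
lemmas computable_dec' [computable_intros] = computable_comp[OF computable_dec]

lemma computable_encI:
  fixes f :: "'a::coded \<Rightarrow> 'b::coded"
  assumes "computable h (\<lambda>x. enc (f x))"
  shows "computable h f"
  using computable_comp[OF computable_dec[where ?'a = 'b] assms] by simp

lemma computable_Suc [computable_intros]: "computable h f \<Longrightarrow> computable h (\<lambda>x. Suc (f x))"
  by (simp add: computable_def enc_nat_def recursive_in_Suc)

lemma computable_rec_nat [computable_intros]:
  fixes s :: "'a::coded \<Rightarrow> nat \<Rightarrow> 'b::coded \<Rightarrow> 'b"
  assumes z: "computable h z" and s: "computable h (\<lambda>p. s (fst p) (fst (snd p)) (snd (snd p)))"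
    and k: "computable h k"
  shows "computable h (\<lambda>x. rec_nat (z x) (s x) (k x))"
proof -
  let ?g = "\<lambda>y r c. enc (s (dec c) y (dec r))"
  have "recursive_in h 3
     (\<lambda>xs. (\<lambda>c. enc ((\<lambda>p. s (fst p) (fst (snd p)) (snd (snd p))) (dec c)))
        (prod_encode (xs ! 2, prod_encode (xs ! 0, xs ! 1))))"
    by (rule recursive_in_comp1, use s in \<open>simp add: computable_def\<close>)
      (intro recursive_in_prod_encode recursive_in.proj; simp)
  then have g: "recursive_in h 3 (\<lambda>xs. ?g (xs ! 0) (xs ! 1) (xs ! 2))"
    by (simp add: dec_prod)
  have "recursive_in h 1 (\<lambda>xs. rec_nat (enc (z (dec (xs ! 0)))) (\<lambda>y r. ?g y r (xs ! 0)) (k (dec (xs ! 0))))"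
    by (rule recursive_in_rec_nat[where f = "\<lambda>c. enc (z (dec c))", OF _ g])
      (use z k in \<open>simp_all add: computable_def recursive_in_proj0' enc_nat_def\<close>)
  moreover have "rec_nat (enc (z (dec c))) (\<lambda>y r. ?g y r c) n = enc (rec_nat (z (dec c)) (s (dec c)) n)"
    for c n by (induction n) auto
  ultimately show ?thesis by (simp add: computable_def)
qed

lemma computable_Least:
  assumes P: "decides h (\<lambda>p. P (fst p) (snd p))" and ex: "\<And>x. \<exists>n. P x n"
  shows "computable h (\<lambda>x. LEAST n::nat. P x n)"
proof -
  \<comment> \<open>The truth value is flipped because minimization looks for a zero.\<close>
  let ?f = "\<lambda>y c. 1 - (if P (dec c) y then 1 else 0 :: nat)"
  have "recursive_in h 2
     (\<lambda>xs. (\<lambda>c. enc ((\<lambda>p. if P (fst p) (snd p) then 1 else 0 :: nat) (dec c)))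
        (prod_encode (xs ! 1, xs ! 0)))"
    by (rule recursive_in_comp1, use P in \<open>simp add: computable_def decides_def\<close>)
      (intro recursive_in_prod_encode recursive_in.proj; simp)
  from recursive_in_diff[OF recursive_in_const[of h 2 1] this]
  have f: "recursive_in h 2 (\<lambda>xs. ?f (xs ! 0) (xs ! 1))"
    by (simp add: dec_prod enc_nat_def)
  have "recursive_in h 1 (\<lambda>xs. LEAST y. ?f y (xs ! 0) = 0)"
    by (rule recursive_in_Least[OF f recursive_in_proj0]) (use ex in auto)
  moreover have "(?f y c = 0) = P (dec c) y" for y c by simp
  ultimately show ?thesis by (simp add: computable_def enc_nat_def)
qed

lemma computable_case_nat [computable_intros]:
  assumes "computable h z" "computable h (\<lambda>p. s (fst p) (snd p))" "computable h k"
  shows "computable h (\<lambda>x. case k x of 0 \<Rightarrow> z x | Suc n \<Rightarrow> s x n)"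
proof -
  have "computable h (\<lambda>x. rec_nat (z x) (\<lambda>n _. s x n) (k x))"
    by (intro computable_intros assms computable_comp2[OF assms(2)])
  moreover have "rec_nat (z x) (\<lambda>n _. s x n) m = (case m of 0 \<Rightarrow> z x | Suc n \<Rightarrow> s x n)" for x m
    by (cases m) auto
  ultimately show ?thesis by simp
qed

lemma computable_if [computable_intros]:
  assumes "decides h P" "computable h f" "computable h g"
  shows "computable h (\<lambda>x. if P x then f x else g x)"
proof -
  have "computable h (\<lambda>x. case (if P x then 1 else 0 :: nat) of 0 \<Rightarrow> g x | Suc n \<Rightarrow> f x)"
    by (intro computable_case_nat assms(1)[unfolded decides_def] assms computable_comp[OF assms(2)]
        computable_intros)
  then show ?thesis by (rule back_subst[of "computable h"]) auto
qed

lemma computable_add [computable_intros]: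
  assumes "computable h f" "computable h g"
  shows "computable h (\<lambda>x. f x + g x :: nat)"
  using assms by (simp add: computable_def enc_nat_def recursive_in_add)

lemma computable_diff [computable_intros]:
  assumes "computable h f" "computable h g"
  shows "computable h (\<lambda>x. f x - g x :: nat)"
  using assms by (simp add: computable_def enc_nat_def recursive_in_diff)

lemma decides_comp:
  assumes "decides h P" "computable h f"
  shows "decides h (\<lambda>x. P (f x))"
  using computable_comp[OF assms(1)[unfolded decides_def] assms(2)] by (simp add: decides_def)

lemma decides_comp2:
  assumes "decides h (\<lambda>p. P (fst p) (snd p))" "computable h f" "computable h g"
  shows "decides h (\<lambda>x. P (f x) (g x))"
  using decides_comp[OF assms(1) computable_Pair[OF assms(2,3)]] by simp

lemma decides_not [computable_intros]: "decides h P \<Longrightarrow> decides h (\<lambda>x. \<not> P x)"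
  unfolding decides_def[of h "\<lambda>x. \<not> P x"]
  by (rule back_subst[of "computable h", OF computable_if[of h P "\<lambda>_. 0" "\<lambda>_. 1"]])
    (auto intro: computable_const)

lemma decides_conj [computable_intros]:
  assumes "decides h P" "decides h Q"
  shows "decides h (\<lambda>x. P x \<and> Q x)"
proof -
  have "computable h (\<lambda>x. if P x then if Q x then 1 else 0 else 0 :: nat)"
    by (intro computable_if computable_const assms)
  then show ?thesis unfolding decides_def by (rule back_subst[of "computable h"]) auto
qed

lemma decides_disj [computable_intros]:
  assumes "decides h P" "decides h Q"
  shows "decides h (\<lambda>x. P x \<or> Q x)"
  using decides_not[OF decides_conj[OF decides_not[OF assms(1)] decides_not[OF assms(2)]]] by simp

lemma decides_eq [computable_intros]:
  assumes "computable h f" "computable h g"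
  shows "decides h (\<lambda>x. f x = g x)"
proof -
  have "computable h (\<lambda>x. 1 - ((enc (f x) - enc (g x)) + (enc (g x) - enc (f x))))"
    by (intro computable_diff computable_add computable_const computable_enc' assms)
  then show ?thesis unfolding decides_def
    by (rule back_subst[of "computable h"])
      (use enc_eq_iff in \<open>fastforce simp: fun_eq_iff simp del: enc_eq_iff\<close>)
qed

section \<open>Computable operations on lists and options\<close>

lemma computable_Cons [computable_intros]:
  assumes "computable h f" "computable h g"
  shows "computable h (\<lambda>x. f x # g x)"
  by (rule computable_encI, unfold enc_Cons) (intro computable_intros assms)

lemma computable_case_list [computable_intros]:
  fixes l :: "'a::coded \<Rightarrow> 'c::coded list"
  assumes "computable h z" "computable h (\<lambda>p. s (fst p) (fst (snd p)) (snd (snd p)))"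
    "computable h l"
  shows "computable h (\<lambda>x. case l x of [] \<Rightarrow> z x | y # ys \<Rightarrow> s x y ys)"
proof -
  have "computable h (\<lambda>x. case enc (l x) of 0 \<Rightarrow> z x | Suc n \<Rightarrow>
      s x (fst (dec n :: 'c \<times> 'c list)) (snd (dec n :: 'c \<times> 'c list)))"
    by (intro computable_case_nat computable_comp3[OF assms(2)] assms computable_comp[OF assms(1)]
        computable_intros)
  then show ?thesis
    by (rule back_subst[of "computable h"]) (auto simp: fun_eq_iff enc_Nil enc_Cons split: list.splits)
qed

lemma computable_case_option [computable_intros]:
  assumes "computable h z" "computable h (\<lambda>p. s (fst p) (snd p))" "computable h l"
  shows "computable h (\<lambda>x. case l x of None \<Rightarrow> z x | Some y \<Rightarrow> s x y)"
proof -
  have "computable h (\<lambda>x. case enc (l x) of 0 \<Rightarrow> z x | Suc n \<Rightarrow> s x (dec n))"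
    by (intro computable_case_nat computable_comp2[OF assms(2)] assms computable_comp[OF assms(1)]
        computable_intros)
  then show ?thesis
    by (rule back_subst[of "computable h"]) (auto simp: fun_eq_iff enc_option_def split: option.splits)
qed

lemma computable_Some [computable_intros]:
  "computable h f \<Longrightarrow> computable h (\<lambda>x. Some (f x))"
  by (rule computable_encI) (auto simp: enc_option_def intro!: computable_intros)

text \<open>Supplies an iteration count for \<open>computable_foldl\<close> that is at hand before
  \<open>length\<close> is known to be computable: the code itself.\<close>

lemma length_le_enc: "length xs \<le> enc xs"
  by (induction xs) (auto simp: enc_Nil enc_Cons enc_Pair intro: order_trans le_prod_encode_2)

lemma computable_foldl [computable_intros]:
  assumes z: "computable h z" and s: "computable h (\<lambda>p. s (fst p) (fst (snd p)) (snd (snd p)))"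
    and l: "computable h l"
  shows "computable h (\<lambda>x. foldl (s x) (z x) (l x))"
proof -
  \<comment> \<open>The state is the unread rest of the list with the accumulator; on an empty rest
    it is unchanged, so iterating too often does no harm.\<close>
  let ?st = "\<lambda>x _ p. case fst p of [] \<Rightarrow> p | y # ys \<Rightarrow> (ys, s x (snd p) y)"
  have "computable h (\<lambda>x. snd (rec_nat (l x, z x) (?st x) (enc (l x))))"
    by (intro computable_intros z l computable_comp3[OF s])
  moreover have "rec_nat (xs, a) (?st x) n = (drop n xs, foldl (s x) a (take n xs))" for x n xs a
  proof (induction n)
    case (Suc n)
    show ?case
    proof (cases "drop n xs")
      case Nil
      then show ?thesis using Suc by simp
    next
      case (Cons y ys)
      then have "n < length xs" by (metis drop_eq_Nil leI list.distinct(1))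
      then have "take (Suc n) xs = take n xs @ [y]" "drop (Suc n) xs = ys"
        using Cons by (auto simp: take_Suc_conv_app_nth) 
          (metis Cons_nth_drop_Suc list.inject)+
      then show ?thesis using Suc Cons by simp
    qed
  qed simp
  ultimately show ?thesis by (simp add: length_le_enc)
qed

lemma computable_rev [computable_intros]:
  assumes "computable h l"
  shows "computable h (\<lambda>x. rev (l x))"
proof -
  have "computable h (\<lambda>x. foldl (\<lambda>a y. y # a) [] (l x))"
    by (intro computable_intros assms)
  moreover have "foldl (\<lambda>a y. y # a) ys xs = rev xs @ ys" for xs ys :: "'b list"
    by (induction xs arbitrary: ys) auto
  ultimately show ?thesis by simp
qed

lemma computable_foldr [computable_intros]:
  assumes "computable h z" "computable h (\<lambda>p. s (fst p) (fst (snd p)) (snd (snd p)))"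
    "computable h l"
  shows "computable h (\<lambda>x. foldr (s x) (l x) (z x))"
  unfolding foldr_conv_foldl by (intro computable_intros assms computable_comp3[OF assms(2)])

lemma computable_map [computable_intros]:
  assumes f: "computable h (\<lambda>p. f (fst p) (snd p))" and l: "computable h l"
  shows "computable h (\<lambda>x. map (f x) (l x))"
proof -
  have "computable h (\<lambda>x. foldr (\<lambda>y r. f x y # r) (l x) [])"
    by (intro computable_intros l computable_comp2[OF f])
  moreover have "foldr (\<lambda>y r. f x y # r) xs [] = map (f x) xs" for x xs
    by (induction xs) auto
  ultimately show ?thesis by simp
qed

lemma computable_filter [computable_intros]:
  assumes P: "decides h (\<lambda>p. P (fst p) (snd p))" and l: "computable h l"
  shows "computable h (\<lambda>x. filter (P x) (l x))"
proof -
  have "computable h (\<lambda>x. foldr (\<lambda>y r. if P x y then y # r else r) (l x) [])"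
    by (intro computable_intros l decides_comp2[OF P])
  moreover have "foldr (\<lambda>y r. if P x y then y # r else r) xs [] = filter (P x) xs" for x xs
    by (induction xs) auto
  ultimately show ?thesis by simp
qed

lemma computable_append [computable_intros]:
  assumes "computable h k" "computable h l"
  shows "computable h (\<lambda>x. k x @ l x)"
proof -
  have "computable h (\<lambda>x. foldr (\<lambda>y r. y # r) (k x) (l x))"
    by (intro computable_intros assms)
  moreover have "foldr (\<lambda>y r. y # r) xs ys = xs @ ys" for xs ys :: "'b list"
    by (induction xs) auto
  ultimately show ?thesis by simp
qed

lemma computable_concat [computable_intros]:
  assumes "computable h l"
  shows "computable h (\<lambda>x. concat (l x))"
proof -
  have "computable h (\<lambda>x. foldr (\<lambda>y r. y @ r) (l x) [])"
    by (intro computable_intros assms)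
  moreover have "foldr (\<lambda>y r. y @ r) xs [] = concat xs" for xs :: "'b list list"
    by (induction xs) auto
  ultimately show ?thesis by simp
qed

lemma computable_length [computable_intros]:
  assumes "computable h l"
  shows "computable h (\<lambda>x. length (l x))"
proof -
  have "computable h (\<lambda>x. foldr (\<lambda>y r. Suc r) (l x) 0)"
    by (intro computable_intros assms)
  moreover have "foldr (\<lambda>y r. Suc r) xs 0 = length xs" for xs :: "'b list"
    by (induction xs) auto
  ultimately show ?thesis by simp
qed

lemma computable_sum_list [computable_intros]:
  assumes "computable h l"
  shows "computable h (\<lambda>x. sum_list (l x) :: nat)"
  unfolding sum_list.eq_foldr by (intro computable_intros assms)

lemma computable_upt [computable_intros]:
  assumes "computable h k"
  shows "computable h (\<lambda>x. [0..<k x])"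
proof -
  have "computable h (\<lambda>x. rec_nat [] (\<lambda>n r. r @ [n]) (k x))"
    by (intro computable_intros assms)
  moreover have "rec_nat [] (\<lambda>n r. r @ [n]) n = [0..<n]" for n :: nat
    by (induction n) auto
  ultimately show ?thesis by simp
qed

lemma computable_hd [computable_intros]:
  assumes "computable h l"
  shows "computable h (\<lambda>x. hd (l x))"
proof -
  have "computable h (\<lambda>x. case l x of [] \<Rightarrow> hd [] | y # _ \<Rightarrow> y)"
    by (intro computable_intros assms)
  moreover have "(case xs of [] \<Rightarrow> hd [] | y # _ \<Rightarrow> y) = hd xs" for xs :: "'b list"
    by (cases xs) auto
  ultimately show ?thesis by simp
qed

lemma computable_tl [computable_intros]:
  "computable h l \<Longrightarrow> computable h (\<lambda>x. tl (l x))"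
  unfolding tl_def by (intro computable_intros)

lemma computable_drop [computable_intros]:
  assumes "computable h k" "computable h l"
  shows "computable h (\<lambda>x. drop (k x) (l x))"
proof -
  have "computable h (\<lambda>x. rec_nat (l x) (\<lambda>_ r. tl r) (k x))"
    by (intro computable_intros assms)
  moreover have "rec_nat xs (\<lambda>_ r. tl r) n = drop n xs" for n and xs :: "'b list"
    by (induction n) (auto simp: drop_Suc tl_drop)
  ultimately show ?thesis by simp
qed

lemma decides_Bex [computable_intros]:
  assumes "computable h l" "decides h (\<lambda>p. P (fst p) (snd p))"
  shows "decides h (\<lambda>x. \<exists>y\<in>set (l x). P x y)"
proof -
  have "decides h (\<lambda>x. \<not> filter (P x) (l x) = [])"
    by (intro computable_intros assms)
  then show ?thesis by (simp add: filter_empty_conv)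
qed

lemma decides_Ball [computable_intros]:
  assumes "computable h l" "decides h (\<lambda>p. P (fst p) (snd p))"
  shows "decides h (\<lambda>x. \<forall>y\<in>set (l x). P x y)"
  using decides_not[OF decides_Bex[OF assms(1) decides_not[OF assms(2)]]] by simp

lemma decides_mem [computable_intros]:
  assumes "computable h f" "computable h l"
  shows "decides h (\<lambda>x. f x \<in> set (l x))"
proof -
  have "decides h (\<lambda>x. \<exists>y\<in>set (l x). y = f x)"
    by (intro computable_intros assms computable_comp[OF assms(1)])
  then show ?thesis by simp
qed

lemma computable_product_lists [computable_intros]:
  assumes "computable h l"
  shows "computable h (\<lambda>x. product_lists (l x))"
proof -
  have "computable h (\<lambda>x. foldr (\<lambda>xs r. concat (map (\<lambda>y. map ((#) y) r) xs)) (l x) [[]])"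
    by (intro computable_intros assms)
  moreover have "foldr (\<lambda>xs r. concat (map (\<lambda>y. map ((#) y) r) xs)) xss [[]] = product_lists xss"
    for xss :: "'b list list"
    by (induction xss) auto
  ultimately show ?thesis by simp
qed

lemma computable_map_of [computable_intros]:
  assumes "computable h l" "computable h k"
  shows "computable h (\<lambda>x. map_of (l x) (k x))"
proof -
  have "computable h (\<lambda>x. case filter (\<lambda>q. fst q = k x) (l x) of [] \<Rightarrow> None | q # _ \<Rightarrow> Some (snd q))"
    by (intro computable_intros assms computable_comp[OF assms(2)])
  moreover have "(case filter (\<lambda>q. fst q = a) xs of [] \<Rightarrow> None | q # _ \<Rightarrow> Some (snd q)) = map_of xs a"
    for a and xs :: "('b \<times> 'c) list"
    by (induction xs) auto
  ultimately show ?thesis by simp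
qed

section \<open>Well-founded recursion\<close>

text \<open>\<open>T\<close> holds the later entries of a table. The first conjunct guarantees that
  every lookup succeeds, so in a justified entry \<open>hd\<close> is never taken of an empty
  list.\<close>

definition justified :: "('a \<Rightarrow> 'a list) \<Rightarrow> ('a \<Rightarrow> 'b list \<Rightarrow> 'b) \<Rightarrow> ('a \<times> 'b) \<Rightarrow> ('a \<times> 'b) list \<Rightarrow> bool"
  where "justified calls \<Phi> p T \<longleftrightarrow>
    (\<forall>y\<in>set (calls (fst p)). \<exists>q\<in>set T. fst q = y) \<and>
    snd p = \<Phi> (fst p) (map (\<lambda>y. snd (hd (filter (\<lambda>q. fst q = y) T))) (calls (fst p)))"

primrec valid_table :: "('a \<Rightarrow> 'a list) \<Rightarrow> ('a \<Rightarrow> 'b list \<Rightarrow> 'b) \<Rightarrow> ('a \<times> 'b) list \<Rightarrow> bool" where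
  "valid_table calls \<Phi> [] \<longleftrightarrow> True"
| "valid_table calls \<Phi> (p # T) \<longleftrightarrow> justified calls \<Phi> p T \<and> valid_table calls \<Phi> T"

text \<open>Replaces the recursion on the table by a bounded quantifier over positions, a form
  covered by the closure rules for \<open>decides\<close>.\<close>

lemma valid_table_iff:
  "valid_table calls \<Phi> T \<longleftrightarrow>
     (\<forall>i\<in>set [0..<length T]. justified calls \<Phi> (hd (drop i T)) (drop (Suc i) T))"
proof (induction T)
  case (Cons p T)
  have "(\<forall>i\<in>set [0..<length (p # T)]. justified calls \<Phi> (hd (drop i (p # T))) (drop (Suc i) (p # T)))
    \<longleftrightarrow> justified calls \<Phi> p T \<and>
      (\<forall>i\<in>set [0..<length T]. justified calls \<Phi> (hd (drop i T)) (drop (Suc i) T))"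
    by (simp only: set_upt length_Cons atLeast0LessThan lessThan_Suc_eq_insert_0) simp
  then show ?case using Cons by simp
qed simp

primrec calls_closed :: "('a \<Rightarrow> 'a list) \<Rightarrow> 'a list \<Rightarrow> bool" where
  "calls_closed calls [] \<longleftrightarrow> True"
| "calls_closed calls (x # xs) \<longleftrightarrow> set (calls x) \<subseteq> set xs \<and> calls_closed calls xs"

lemma calls_closed_append:
  "calls_closed calls xs \<Longrightarrow> calls_closed calls ys \<Longrightarrow> calls_closed calls (xs @ ys)"
  by (induction xs) auto

text \<open>Each argument makes finitely many calls, so by well-founded induction closed lists for
  the calls can be appended and the argument put in front.\<close>

lemma calls_closed_exists:
  assumes "wf r" and dec: "\<And>x y. y \<in> set (calls x) \<Longrightarrow> (y, x) \<in> r"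
  shows "\<exists>xs. calls_closed calls xs \<and> x \<in> set xs"
  using \<open>wf r\<close>
proof (induction x)
  case (less x)
  have "\<exists>xs. calls_closed calls xs \<and> set zs \<subseteq> set xs" if "set zs \<subseteq> set (calls x)" for zs
    using that
  proof (induction zs)
    case Nil
    show ?case by (rule exI[of _ "[]"]) simp
  next
    case (Cons z zs)
    then obtain xs where xs: "calls_closed calls xs" "set zs \<subseteq> set xs" by auto
    from Cons.prems dec less obtain ys where "calls_closed calls ys" "z \<in> set ys"
      by (metis list.set_intros(1) subsetD)
    with xs show ?case by (intro exI[of _ "xs @ ys"]) (auto intro: calls_closed_append)
  qed
  then obtain xs where "calls_closed calls xs" "set (calls x) \<subseteq> set xs" by blast
  then show ?case by (intro exI[of _ "x # xs"]) simp
qed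

text \<open>The value at \<open>x\<close> is read off the first list of argument-value pairs which contains \<open>x\<close> and in
  which each pair is justified by the pairs after it.\<close>

lemma computable_recursion:
  fixes f :: "'a::coded \<Rightarrow> 'b::coded"
  assumes wf: "wf r" and dec: "\<And>x y. y \<in> set (calls x) \<Longrightarrow> (y, x) \<in> r"
    and f: "\<And>x. f x = \<Phi> x (map f (calls x))"
    and calls: "computable h calls" and \<Phi>: "computable h (\<lambda>p. \<Phi> (fst p) (snd p))"
  shows "computable h f"
proof -
  let ?val = "\<lambda>(T :: ('a \<times> 'b) list) y. snd (hd (filter (\<lambda>q. fst q = y) T))"
  let ?P = "\<lambda>x n. valid_table calls \<Phi> (dec n) \<and> (\<exists>q\<in>set (dec n :: ('a \<times> 'b) list). fst q = x)"
  have val: "?val T y = f y"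
    if "\<exists>q\<in>set T. fst q = y" "\<forall>q\<in>set T. snd q = f (fst q)" for T y
  proof -
    have "hd (filter (\<lambda>q. fst q = y) T) \<in> set (filter (\<lambda>q. fst q = y) T)"
      by (rule hd_in_set) (use that(1) in \<open>auto simp: filter_empty_conv\<close>)
    then show ?thesis using that(2) by auto
  qed
  have step: "justified calls \<Phi> p T \<longleftrightarrow> (\<forall>y\<in>set (calls (fst p)). \<exists>q\<in>set T. fst q = y) \<and> snd p = f (fst p)"
    if "\<forall>q\<in>set T. snd q = f (fst q)" for p T
  proof (cases "\<forall>y\<in>set (calls (fst p)). \<exists>q\<in>set T. fst q = y")
    case True
    then have *: "map (?val T) (calls (fst p)) = map f (calls (fst p))"
      using val[OF _ that] by simp
    show ?thesis unfolding justified_def * f[symmetric] ..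
  qed (auto simp: justified_def)
  \<comment> \<open>Correctness passes from the end of the table to its head; well-foundedness
    enters in \<open>ex\<close>, where a table has to exist.\<close>
  have sound: "\<forall>q\<in>set T. snd q = f (fst q)" if "valid_table calls \<Phi> T" for T
    using that by (induction T) (auto simp: step)
  have graph: "valid_table calls \<Phi> (map (\<lambda>x. (x, f x)) xs)" if "calls_closed calls xs" for xs
    using that by (induction xs) (auto simp: step subset_iff)
  have ex: "\<exists>n. ?P x n" for x
  proof -
    obtain xs where "calls_closed calls xs" "x \<in> set xs"
      using calls_closed_exists[OF wf dec] by blast
    then show ?thesis
      using graph by (intro exI[of _ "enc (map (\<lambda>x. (x, f x)) xs)"]) auto
  qed
  have P: "decides h (\<lambda>p. ?P (fst p) (snd p))"
    unfolding valid_table_iff justified_def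
    by (intro computable_intros computable_comp[OF calls] computable_comp2[OF \<Phi>])
  \<comment> \<open>Any valid table containing \<open>x\<close> would do; taking the least code
    makes the choice computable.\<close>
  have "computable h (\<lambda>x. ?val (dec (LEAST n. ?P x n)) x)"
    by (intro computable_intros computable_Least[OF P ex] computable_comp[OF computable_Least[OF P ex]])
  moreover have "?val (dec (LEAST n. ?P x n)) x = f x" for x
    using LeastI_ex[OF ex[of x]] sound val by blast
  ultimately show ?thesis by simp
qed

section \<open>Evaluation of formulas in finite groups\<close>

lemma add_le_prod_encode: "a + b \<le> prod_encode (a, b)"
proof -
  have "n \<le> triangle n" for n by (induction n) auto
  then show ?thesis by (simp add: prod_encode_def trans_le_add1)
qed

text \<open>The components of a pair add up to at most its code, so a nonzero tag leaves strictly
  smaller arguments. The tag 0 is a true exception, as \<open>prod_encode (0, 1) = 1\<close>; at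
  that tag neither evaluator calls itself.\<close>

lemma prod_decode_decreasing:
  assumes "fst (prod_decode n) \<noteq> 0"
  shows "snd (prod_decode n) < n" "fst (prod_decode (snd (prod_decode n))) < n"
    "snd (prod_decode (snd (prod_decode n))) < n"
proof -
  have *: "fst (prod_decode k) + snd (prod_decode k) \<le> k" for k
    using add_le_prod_encode[of "fst (prod_decode k)" "snd (prod_decode k)"] by simp
  show "snd (prod_decode n) < n" "fst (prod_decode (snd (prod_decode n))) < n"
    "snd (prod_decode (snd (prod_decode n))) < n"
    using *[of n] *[of "snd (prod_decode n)"] assms by auto
qed

text \<open>\<open>teval\<close> and \<open>feval\<close> work on codes; they return \<^const>\<open>None\<close> if the number is not a code or if
  a variable has no value in the environment \<open>e\<close>. A finite group is given by a list \<open>E\<close> of its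
  elements, its multiplication \<open>m\<close> and its unit \<open>u\<close>.\<close>

function teval :: "('e \<Rightarrow> 'e \<Rightarrow> 'e) \<Rightarrow> 'e list \<Rightarrow> 'e \<Rightarrow> nat \<Rightarrow> (nat \<times> 'e) list \<Rightarrow> 'e option" where
  "teval m E u n e =
    (if fst (prod_decode n) = 0 then map_of e (snd (prod_decode n))
     else if fst (prod_decode n) = 1 then (if snd (prod_decode n) = 0 then Some u else None)
     else if fst (prod_decode n) = 2 then
       (case teval m E u (fst (prod_decode (snd (prod_decode n)))) e of None \<Rightarrow> None
        | Some a \<Rightarrow> (case teval m E u (snd (prod_decode (snd (prod_decode n)))) e of None \<Rightarrow> None
          | Some b \<Rightarrow> Some (m a b)))
     else if fst (prod_decode n) = 3 then
       (case teval m E u (snd (prod_decode n)) e of None \<Rightarrow> None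
        | Some a \<Rightarrow> Some (hd (filter (\<lambda>b. m b a = u) E)))
     else None)"
  by pat_completeness auto
termination
  by (relation "measure (\<lambda>(m, E, u, n, e). n)") (auto intro: prod_decode_decreasing)

function feval :: "('e \<Rightarrow> 'e \<Rightarrow> 'e) \<Rightarrow> 'e list \<Rightarrow> 'e \<Rightarrow> nat \<Rightarrow> (nat \<times> 'e) list \<Rightarrow> nat option" where
  "feval m E u n e =
    (if fst (prod_decode n) = 0 then
       (case teval m E u (fst (prod_decode (snd (prod_decode n)))) e of None \<Rightarrow> None
        | Some a \<Rightarrow> (case teval m E u (snd (prod_decode (snd (prod_decode n)))) e of None \<Rightarrow> None
          | Some b \<Rightarrow> Some (if a = b then 1 else 0)))
     else if fst (prod_decode n) = 1 then
       (case feval m E u (snd (prod_decode n)) e of None \<Rightarrow> None | Some a \<Rightarrow> Some (1 - a))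
     else if fst (prod_decode n) = 2 then
       (case feval m E u (fst (prod_decode (snd (prod_decode n)))) e of None \<Rightarrow> None
        | Some a \<Rightarrow> (case feval m E u (snd (prod_decode (snd (prod_decode n)))) e of None \<Rightarrow> None
          | Some b \<Rightarrow> Some (if a = 1 \<and> b = 1 then 1 else 0)))
     else if fst (prod_decode n) = 3 then
       (if None \<in> set (map (\<lambda>p. feval m E u (snd (prod_decode (snd (prod_decode n))))
              ((fst (prod_decode (snd (prod_decode n))), p) # e)) E) then None
        else Some (if Some 1 \<in> set (map (\<lambda>p. feval m E u (snd (prod_decode (snd (prod_decode n))))
              ((fst (prod_decode (snd (prod_decode n))), p) # e)) E) then 1 else 0))
     else None)"
  by pat_completeness auto
termination
  by (relation "measure (\<lambda>(m, E, u, n, e). n)") (auto intro: prod_decode_decreasing)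

declare teval.simps [simp del] feval.simps [simp del]

lemma computable_prod_decode [computable_intros]:
  "computable h f \<Longrightarrow> computable h (\<lambda>x. prod_decode (f x))"
  by (rule computable_encI) (simp add: enc_prod_def enc_nat_def)

context
  fixes m :: "'e::coded \<Rightarrow> 'e \<Rightarrow> 'e" and E :: "'s::coded \<Rightarrow> 'e list" and u :: "'s \<Rightarrow> 'e"
    and h :: "nat \<Rightarrow> nat"
  assumes m: "computable h (\<lambda>p. m (fst p) (snd p))" and E: "computable h E" and u: "computable h u"
begin

lemma computable_teval:
  "computable h (\<lambda>(x :: 's \<times> nat \<times> (nat \<times> 'e) list).
     teval m (E (fst x)) (u (fst x)) (fst (snd x)) (snd (snd x)))"
proof (rule computable_recursion[OF wf_measure[of "\<lambda>x. fst (snd x)"]])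
  let ?n = "\<lambda>x :: 's \<times> nat \<times> (nat \<times> 'e) list. prod_decode (fst (snd x))"
  let ?calls = "\<lambda>x. if fst (?n x) = 2 then
      [(fst x, fst (prod_decode (snd (?n x))), snd (snd x)),
       (fst x, snd (prod_decode (snd (?n x))), snd (snd x))]
    else if fst (?n x) = 3 then [(fst x, snd (?n x), snd (snd x))] else []"
  \<comment> \<open>\<open>vs\<close> lists the values of \<open>?calls\<close> in order, so
    \<open>hd vs\<close> and \<open>hd (tl vs)\<close> belong to the first and the second
    subterm.\<close>
  let ?\<Phi> = "\<lambda>x vs. if fst (?n x) = 0 then map_of (snd (snd x)) (snd (?n x))
     else if fst (?n x) = 1 then (if snd (?n x) = 0 then Some (u (fst x)) else None)
     else if fst (?n x) = 2 then
       (case hd vs of None \<Rightarrow> None | Some a \<Rightarrow> (case hd (tl vs) of None \<Rightarrow> None | Some b \<Rightarrow> Some (m a b)))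
     else if fst (?n x) = 3 then
       (case hd vs of None \<Rightarrow> None | Some a \<Rightarrow> Some (hd (filter (\<lambda>b. m b a = u (fst x)) (E (fst x)))))
     else None"
  show "computable h ?calls" by (intro computable_intros)
  show "computable h (\<lambda>p. ?\<Phi> (fst p) (snd p))"
    by (intro computable_intros computable_comp[OF E] computable_comp[OF u] computable_comp2[OF m])
  show "teval m (E (fst x)) (u (fst x)) (fst (snd x)) (snd (snd x)) =
     ?\<Phi> x (map (\<lambda>x. teval m (E (fst x)) (u (fst x)) (fst (snd x)) (snd (snd x))) (?calls x))" for x
    by (rule trans[OF teval.simps], cases "fst (?n x) = 2"; cases "fst (?n x) = 3")
      (simp_all split: option.split)
  show "(y, x) \<in> measure (\<lambda>x. fst (snd x))" if "y \<in> set (?calls x)" for x y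
    using that by (auto split: if_splits simp: prod_decode_decreasing)
qed

text \<open>At a quantifier the environment grows while the code shrinks, so the environment belongs
  to the argument of the recursion and the measure looks at the code only.\<close>

lemma computable_feval:
  "computable h (\<lambda>(x :: 's \<times> nat \<times> (nat \<times> 'e) list).
     feval m (E (fst x)) (u (fst x)) (fst (snd x)) (snd (snd x)))"
proof (rule computable_recursion[OF wf_measure[of "\<lambda>x. fst (snd x)"]])
  let ?n = "\<lambda>x :: 's \<times> nat \<times> (nat \<times> 'e) list. prod_decode (fst (snd x))"
  let ?calls = "\<lambda>x. if fst (?n x) = 1 then [(fst x, snd (?n x), snd (snd x))]
    else if fst (?n x) = 2 then
      [(fst x, fst (prod_decode (snd (?n x))), snd (snd x)),
       (fst x, snd (prod_decode (snd (?n x))), snd (snd x))]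
    else if fst (?n x) = 3 then map (\<lambda>p. (fst x, snd (prod_decode (snd (?n x))),
       (fst (prod_decode (snd (?n x))), p) # snd (snd x))) (E (fst x)) else []"
  let ?t = "\<lambda>x n. teval m (E (fst x)) (u (fst x)) n (snd (snd x))"
  let ?\<Phi> = "\<lambda>x vs. if fst (?n x) = 0 then
       (case ?t x (fst (prod_decode (snd (?n x)))) of None \<Rightarrow> None
        | Some a \<Rightarrow> (case ?t x (snd (prod_decode (snd (?n x)))) of None \<Rightarrow> None
          | Some b \<Rightarrow> Some (if a = b then 1 else 0 :: nat)))
     else if fst (?n x) = 1 then (case hd vs of None \<Rightarrow> None | Some a \<Rightarrow> Some (1 - a))
     else if fst (?n x) = 2 then
       (case hd vs of None \<Rightarrow> None | Some a \<Rightarrow> (case hd (tl vs) of None \<Rightarrow> None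
         | Some b \<Rightarrow> Some (if a = 1 \<and> b = 1 then 1 else 0)))
     else if fst (?n x) = 3 then
       (if None \<in> set vs then None else Some (if Some 1 \<in> set vs then 1 else 0))
     else None"
  show "computable h ?calls" by (intro computable_intros computable_comp[OF E])
  \<comment> \<open>The terms of an equation are evaluated by a function already known to be
    computable, so they do not occur in \<open>?calls\<close>.\<close>
  have t: "computable h (\<lambda>x. ?t (fst x) (snd x))"
    using computable_comp[OF computable_teval, of "\<lambda>p. (fst (fst p), snd p, snd (snd (fst p)))"]
    by (simp add: computable_intros)
  show "computable h (\<lambda>p. ?\<Phi> (fst p) (snd p))"
    by (intro computable_intros computable_comp2[OF t])
  show "feval m (E (fst x)) (u (fst x)) (fst (snd x)) (snd (snd x)) =
     ?\<Phi> x (map (\<lambda>x. feval m (E (fst x)) (u (fst x)) (fst (snd x)) (snd (snd x))) (?calls x))" for x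
    by (rule trans[OF feval.simps], cases "fst (?n x) = 1"; cases "fst (?n x) = 2";
        cases "fst (?n x) = 3") (simp_all add: comp_def split: option.split)
  show "(y, x) \<in> measure (\<lambda>x. fst (snd x))" if "y \<in> set (?calls x)" for x y
    using that by (auto split: if_splits simp: prod_decode_decreasing)
qed

end

section \<open>Evaluation on codes compared with satisfaction in a group\<close>

lemma teval_code: "teval m E u n e \<noteq> None \<Longrightarrow> \<exists>t. n = tcode t"
proof (induction n rule: less_induct)
  case (less n)
  obtain k r where n: "n = prod_encode (k, r)" by (metis prod_decode_inverse surj_pair)
  obtain a b where r: "r = prod_encode (a, b)" by (metis prod_decode_inverse surj_pair)
  have lt: "r < n" "a < n" "b < n" if "k \<noteq> 0"
    using prod_decode_decreasing[of n] that by (simp_all add: n r)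
  consider "k = 0" | "k = 1" "r = 0" | "k = 2" "teval m E u a e \<noteq> None" "teval m E u b e \<noteq> None"
    | "k = 3" "teval m E u r e \<noteq> None"
    using less.prems unfolding n teval.simps[of m E u "prod_encode (k, r)"]
    by (auto split: if_splits option.splits simp: r)
  then show ?case
  proof cases
    case 1
    then show ?thesis by (intro exI[of _ "TVar r"]) (simp add: n)
  next
    case 2
    then show ?thesis by (intro exI[of _ TOne]) (simp add: n)
  next
    case 3
    then obtain s t where "a = tcode s" "b = tcode t"
      using less.IH[OF lt(2)] less.IH[OF lt(3)] by auto
    then show ?thesis using 3 by (intro exI[of _ "TMult s t"]) (simp add: n r)
  next
    case 4
    then obtain t where "r = tcode t"
      using less.IH[OF lt(1)] by auto
    then show ?thesis using 4 by (intro exI[of _ "TInv t"]) (simp add: n)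
  qed
qed

text \<open>At a quantifier the body is evaluated for some \<open>p\<close> in \<open>E\<close>;
  over an empty list such a node would return \<open>Some 0\<close> whatever its body is.\<close>

lemma feval_code:
  assumes "E \<noteq> []"
  shows "feval m E u n e \<noteq> None \<Longrightarrow> \<exists>\<phi>. n = fcode \<phi>"
proof (induction n arbitrary: e rule: less_induct)
  case (less n)
  obtain k r where n: "n = prod_encode (k, r)" by (metis prod_decode_inverse surj_pair)
  obtain a b where r: "r = prod_encode (a, b)" by (metis prod_decode_inverse surj_pair)
  have lt: "r < n" "a < n" "b < n" if "k \<noteq> 0"
    using prod_decode_decreasing[of n] that by (simp_all add: n r)
  obtain p where p: "p \<in> set E" using assms by (cases E) auto
  consider "k = 0" "teval m E u a e \<noteq> None" "teval m E u b e \<noteq> None"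
    | "k = 1" "feval m E u r e \<noteq> None"
    | "k = 2" "feval m E u a e \<noteq> None" "feval m E u b e \<noteq> None"
    | "k = 3" "feval m E u b ((a, p) # e) \<noteq> None"
    using less.prems p unfolding n feval.simps[of m E u "prod_encode (k, r)"]
    by (auto split: if_splits option.splits simp: r image_iff eq_commute[of None] simp del: not_None_eq)
  then show ?case
  proof cases
    case 1
    then obtain s t where "a = tcode s" "b = tcode t"
      using teval_code[of m E u a e] teval_code[of m E u b e] by auto
    then show ?thesis using 1 by (intro exI[of _ "FEq s t"]) (simp add: n r)
  next
    case 2
    then obtain \<phi> where "r = fcode \<phi>"
      using less.IH[OF lt(1), of e] by auto
    then show ?thesis using 2 by (intro exI[of _ "FNeg \<phi>"]) (simp add: n)
  next
    case 3
    then obtain \<phi> \<psi> where "a = fcode \<phi>" "b = fcode \<psi>"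
      using less.IH[OF lt(2), of e] less.IH[OF lt(3), of e] by auto
    then show ?thesis using 3 by (intro exI[of _ "FConj \<phi> \<psi>"]) (simp add: n r)
  next
    case 4
    then obtain \<phi> where "b = fcode \<phi>"
      using less.IH[OF lt(3), of "(a, p) # e"] by auto
    then show ?thesis using 4 by (intro exI[of _ "FEx a \<phi>"]) (simp add: n r)
  qed
qed

lemma teval_TVar: "teval m E u (tcode (TVar k)) e = map_of e k"
  by (subst teval.simps) simp

lemma teval_TOne: "teval m E u (tcode TOne) e = Some u"
  by (subst teval.simps) simp

lemma teval_TMult: "teval m E u (tcode (TMult s t)) e =
    (case teval m E u (tcode s) e of None \<Rightarrow> None
     | Some a \<Rightarrow> (case teval m E u (tcode t) e of None \<Rightarrow> None | Some b \<Rightarrow> Some (m a b)))"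
  by (subst teval.simps) (simp cong: option.case_cong)

lemma teval_TInv: "teval m E u (tcode (TInv t)) e =
    (case teval m E u (tcode t) e of None \<Rightarrow> None
     | Some a \<Rightarrow> Some (hd (filter (\<lambda>b. m b a = u) E)))"
  by (subst teval.simps) simp

lemma feval_FEq: "feval m E u (fcode (FEq s t)) e =
    (case teval m E u (tcode s) e of None \<Rightarrow> None
     | Some a \<Rightarrow> (case teval m E u (tcode t) e of None \<Rightarrow> None
       | Some b \<Rightarrow> Some (if a = b then 1 else 0)))"
  by (subst feval.simps) (simp cong: option.case_cong)

lemma feval_FNeg: "feval m E u (fcode (FNeg \<phi>)) e =
    (case feval m E u (fcode \<phi>) e of None \<Rightarrow> None | Some a \<Rightarrow> Some (1 - a))"
  by (subst feval.simps) simp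

lemma feval_FConj: "feval m E u (fcode (FConj \<phi> \<psi>)) e =
    (case feval m E u (fcode \<phi>) e of None \<Rightarrow> None
     | Some a \<Rightarrow> (case feval m E u (fcode \<psi>) e of None \<Rightarrow> None
       | Some b \<Rightarrow> Some (if a = 1 \<and> b = 1 then 1 else 0)))"
  by (subst feval.simps) (simp cong: option.case_cong)

lemma feval_FEx: "feval m E u (fcode (FEx k \<phi>)) e =
    (if \<exists>p\<in>set E. feval m E u (fcode \<phi>) ((k, p) # e) = None then None
     else Some (if \<exists>p\<in>set E. feval m E u (fcode \<phi>) ((k, p) # e) = Some 1 then 1 else 0))"
  by (subst feval.simps) (auto simp: image_iff eq_commute[of None] eq_commute[of "Some (Suc 0)"])

lemma tval_cong: "(\<And>k. k \<in> tvars t \<Longrightarrow> e k = e' k) \<Longrightarrow> tval M e t = tval M e' t"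
  by (induction t) auto

lemma sat_cong: "(\<And>k. k \<in> free_vars \<phi> \<Longrightarrow> e k = e' k) \<Longrightarrow> sat M e \<phi> \<longleftrightarrow> sat M e' \<phi>"
proof (induction \<phi> arbitrary: e e')
  case (FEq s t)
  then have "tval M e s = tval M e' s" "tval M e t = tval M e' t" by (auto intro: tval_cong)
  then show ?case by simp
next
  case (FNeg \<phi>)
  have "sat M e \<phi> \<longleftrightarrow> sat M e' \<phi>" by (rule FNeg.IH) (use FNeg.prems in simp)
  then show ?case by simp
next
  case (FConj \<phi> \<psi>)
  have "sat M e \<phi> \<longleftrightarrow> sat M e' \<phi>" by (rule FConj.IH) (use FConj.prems in simp)
  moreover have "sat M e \<psi> \<longleftrightarrow> sat M e' \<psi>" by (rule FConj.IH) (use FConj.prems in simp)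
  ultimately show ?case by simp
next
  case (FEx k \<phi>)
  have "sat M (e(k := a)) \<phi> \<longleftrightarrow> sat M (e'(k := a)) \<phi>" for a
    by (rule FEx.IH) (use FEx.prems in auto)
  then show ?case by simp
qed

lemma tval_closed:
  assumes "group M" "\<And>k. e k \<in> carrier M"
  shows "tval M e t \<in> carrier M"
proof -
  interpret group M by fact
  show ?thesis using assms(2) by (induction t) auto
qed

text \<open>A sentence has the same value in all environments, so a single one, with values in the
  carrier, can be tested.\<close>

lemma mem_group_theory_iff:
  assumes "\<And>k. e k \<in> carrier M"
  shows "\<phi> \<in> group_theory M \<longleftrightarrow> free_vars \<phi> = {} \<and> sat M e \<phi>"
proof -
  have "sat M e' \<phi> \<longleftrightarrow> sat M e \<phi>" if "free_vars \<phi> = {}" for e'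
    by (rule sat_cong) (simp add: that)
  moreover have "range e \<subseteq> carrier M" using assms by auto
  ultimately show ?thesis unfolding group_theory_def sentence_def by blast
qed

text \<open>The default is the unit, which lies in every group. The evaluators answer
  \<open>None\<close> at a variable without a value, so the default only makes the environment
  total.\<close>

definition env_of :: "('a, 'b) monoid_scheme \<Rightarrow> (nat \<times> 'a) list \<Rightarrow> nat \<Rightarrow> 'a" where
  "env_of M e k = (case map_of e k of None \<Rightarrow> \<one>\<^bsub>M\<^esub> | Some a \<Rightarrow> a)"

lemma env_of_Cons: "env_of M ((k, a) # e) = (env_of M e)(k := a)"
  by (auto simp: env_of_def)

text \<open>\<open>\<rho>\<close> is an isomorphism onto a coded copy of \<open>M\<close>. The
  operation \<open>m\<close> is constrained on the image only, and \<open>E\<close> may list an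
  element several times, as happens when different tree strings restrict to the same
  permutation.\<close>

locale finite_group_code = group M for M :: "('a, 'b) monoid_scheme" (structure) +
  fixes m :: "'e \<Rightarrow> 'e \<Rightarrow> 'e" and E :: "'e list" and u :: 'e and \<rho> :: "'a \<Rightarrow> 'e"
  assumes inj: "inj_on \<rho> (carrier M)" and elements: "\<rho> ` carrier M = set E"
    and mult: "x \<in> carrier M \<Longrightarrow> y \<in> carrier M \<Longrightarrow> \<rho> (x \<otimes> y) = m (\<rho> x) (\<rho> y)"
    and unit: "\<rho> \<one> = u"
begin

lemma env_of_closed: "snd ` set e \<subseteq> carrier M \<Longrightarrow> env_of M e k \<in> carrier M"
  by (force simp: env_of_def split: option.split dest: map_of_SomeD)

abbreviation env_code :: "(nat \<times> 'a) list \<Rightarrow> (nat \<times> 'e) list" where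
  "env_code e \<equiv> map (\<lambda>(k, a). (k, \<rho> a)) e"

text \<open>Left inverses in a group are unique, so all entries that survive the filter are
  equal.\<close>

lemma inv_code:
  assumes "x \<in> carrier M"
  shows "hd (filter (\<lambda>b. m b (\<rho> x) = u) E) = \<rho> (inv x)"
proof -
  have *: "b = \<rho> (inv x)" if "b \<in> set E" "m b (\<rho> x) = u" for b
  proof -
    from that obtain y where y: "y \<in> carrier M" "b = \<rho> y" using elements by auto
    then have "\<rho> (y \<otimes> x) = \<rho> \<one>" using that assms by (simp add: mult unit)
    then have "y \<otimes> x = \<one>" using inj y assms by (auto dest: inj_onD)
    then show ?thesis using y assms by (metis inv_equality)
  qed
  have "\<rho> (inv x) \<in> set E" "m (\<rho> (inv x)) (\<rho> x) = u"
    using assms elements by (auto simp: unit simp flip: mult)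
  then have "filter (\<lambda>b. m b (\<rho> x) = u) E \<noteq> []" by (auto simp: filter_empty_conv)
  from hd_in_set[OF this] show ?thesis by (intro *) auto
qed

lemma teval_eq:
  assumes "snd ` set e \<subseteq> carrier M"
  shows "teval m E u (tcode t) (env_code e) =
    (if tvars t \<subseteq> fst ` set e then Some (\<rho> (tval M (env_of M e) t)) else None)"
proof (induction t)
  case (TVar k)
  show ?case
    by (auto simp: teval_TVar map_of_map env_of_def map_of_eq_None_iff split: option.splits
        simp del: tcode.simps)
next
  case (TMult s t)
  then show ?case
    using tval_closed[OF is_group env_of_closed[OF assms]]
    by (simp add: teval_TMult mult del: tcode.simps)
next
  case (TInv t)
  then show ?case
    using tval_closed[OF is_group env_of_closed[OF assms]]
    by (simp add: teval_TInv inv_code del: tcode.simps)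
qed (simp add: teval_TOne unit del: tcode.simps)

lemma feval_eq:
  assumes "snd ` set e \<subseteq> carrier M"
  shows "feval m E u (fcode \<phi>) (env_code e) =
    (if free_vars \<phi> \<subseteq> fst ` set e then Some (if sat M (env_of M e) \<phi> then 1 else 0) else None)"
  using assms
proof (induction \<phi> arbitrary: e)
  case (FEq s t)
  have "\<rho> (tval M (env_of M e) s) = \<rho> (tval M (env_of M e) t)
      \<longleftrightarrow> tval M (env_of M e) s = tval M (env_of M e) t"
    using inj tval_closed[OF is_group env_of_closed[OF FEq]] by (simp add: inj_on_eq_iff)
  then show ?case by (simp add: feval_FEq teval_eq[OF FEq] del: fcode.simps)
next
  case (FNeg \<phi>)
  then show ?case by (simp add: feval_FNeg del: fcode.simps)
next
  case (FConj \<phi> \<psi>)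
  then show ?case by (simp add: feval_FConj del: fcode.simps)
next
  case (FEx k \<phi>)
  have *: "feval m E u (fcode \<phi>) ((k, \<rho> a) # env_code e) =
      (if free_vars \<phi> - {k} \<subseteq> fst ` set e
       then Some (if sat M ((env_of M e)(k := a)) \<phi> then 1 else 0) else None)"
    if "a \<in> carrier M" for a
    using FEx.IH[of "(k, a) # e"] FEx.prems that
    by (auto simp: env_of_Cons subset_insert_iff)
  show ?case
    \<comment> \<open>The unit gives a nonempty range to the quantified variable; over an empty
      range a missing value in the body would go unnoticed.\<close>
    using one_closed by (auto simp: feval_FEx * simp del: fcode.simps simp flip: elements)
qed

text \<open>The answer \<open>Some 1\<close> settles three questions at once: \<open>n\<close> is a
  code because others evaluate to \<open>None\<close>, the formula is a sentence because the
  environment is empty, and it is true.\<close>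

lemma mem_theory_iff_feval: "n \<in> fcode ` group_theory M \<longleftrightarrow> feval m E u n [] = Some 1"
proof -
  have "E \<noteq> []" using elements one_closed by (metis empty_iff image_is_empty list.set(1))
  then have code: "\<exists>\<phi>. n = fcode \<phi>" if "feval m E u n [] = Some 1"
    using feval_code[of E m u n "[]"] that by auto
  have "\<phi> \<in> group_theory M \<longleftrightarrow> feval m E u (fcode \<phi>) [] = Some 1" for \<phi>
    using feval_eq[of "[]" \<phi>] mem_group_theory_iff[of "env_of M []" M \<phi>] env_of_closed[of "[]"]
    by simp
  with code show ?thesis by blast
qed

end

section \<open>Truth in products depends on bounded counts of colours\<close>

text \<open>\<open>card\<close> is 0 on infinite sets, hence the separate disjunct.\<close>

definition big :: "nat \<Rightarrow> 'a set \<Rightarrow> bool" where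
  "big c X \<longleftrightarrow> infinite X \<or> c \<le> card X"

text \<open>Equality of cardinalities truncated at \<open>c\<close>. A finite set of at least
  \<open>c\<close> elements is similar to an infinite one, which lets finite subproducts imitate the
  infinite product.\<close>

definition similar :: "nat \<Rightarrow> 'a set \<Rightarrow> 'b set \<Rightarrow> bool" where
  "similar c X Y \<longleftrightarrow> finite X \<and> finite Y \<and> card X = card Y \<or> big c X \<and> big c Y"

lemma big_mono: "big c X \<Longrightarrow> X \<subseteq> Y \<Longrightarrow> c' \<le> c \<Longrightarrow> big c' Y"
  unfolding big_def by (meson card_mono dual_order.trans finite_subset)

lemma big_subset:
  assumes "big c X"
  obtains Z where "Z \<subseteq> X" "finite Z" "card Z = c"
proof (cases "finite X")
  case True
  with assms have "c \<le> card X" by (simp add: big_def)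
  from obtain_subset_with_card_n[OF this] that show thesis by blast
next
  case False
  from infinite_arbitrarily_large[OF this, of c] that show thesis by blast
qed

lemma similar_mono: "similar c X Y \<Longrightarrow> c' \<le> c \<Longrightarrow> similar c' X Y"
  unfolding similar_def by (meson big_mono order_refl)

lemma similar_sym: "similar c X Y \<Longrightarrow> similar c Y X"
  unfolding similar_def by auto

lemma similar_empty_iff: "similar c X Y \<Longrightarrow> 0 < c \<Longrightarrow> X = {} \<longleftrightarrow> Y = {}"
  by (auto simp: similar_def big_def)

lemma similar_bij_betw: "bij_betw f X Y \<Longrightarrow> similar c X Y"
  unfolding similar_def big_def by (meson bij_betw_finite bij_betw_same_card)

text \<open>If one of the two pairs is big then so are both unions; otherwise all cardinalities are
  finite and add up.\<close>

lemma similar_Un: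
  assumes "similar c X Y" "similar c X' Y'" "X \<inter> X' = {}" "Y \<inter> Y' = {}"
  shows "similar c (X \<union> X') (Y \<union> Y')"
proof (cases "finite X \<and> finite Y \<and> card X = card Y \<and> finite X' \<and> finite Y' \<and> card X' = card Y'")
  case True
  then show ?thesis using assms by (simp add: similar_def card_Un_disjoint)
next
  case False
  then have "big c X \<and> big c Y \<or> big c X' \<and> big c Y'"
    using assms by (auto simp: similar_def)
  then have "big c (X \<union> X') \<and> big c (Y \<union> Y')"
    by (metis big_mono Un_upper1 Un_upper2 order_refl)
  then show ?thesis by (simp add: similar_def)
qed

lemma similar_UN:
  assumes "finite T" "\<And>t. t \<in> T \<Longrightarrow> similar c (X t) (Y t)"
    "disjoint_family_on X T" "disjoint_family_on Y T"
  shows "similar c (\<Union>t\<in>T. X t) (\<Union>t\<in>T. Y t)"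
  using assms
proof (induction T)
  case empty
  show ?case by (simp add: similar_def)
next
  case (insert t T)
  have "similar c (X t \<union> (\<Union>t\<in>T. X t)) (Y t \<union> (\<Union>t\<in>T. Y t))"
  proof (rule similar_Un)
    show "similar c (\<Union>t\<in>T. X t) (\<Union>t\<in>T. Y t)"
      using insert.prems by (intro insert.IH) (auto simp: disjoint_family_on_def)
    show "X t \<inter> (\<Union>t\<in>T. X t) = {}" "Y t \<inter> (\<Union>t\<in>T. Y t) = {}"
      using insert.hyps insert.prems(2,3) by (fastforce simp: disjoint_family_on_def)+
  qed (use insert.prems in auto)
  then show ?case by simp
qed

text \<open>A move in the Ehrenfeucht--Fraisse game: the colouring \<open>L\<close> of
  \<open>X\<close> is answered by \<open>g\<close> on \<open>Y\<close>. Among \<open>c * B\<close>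
  elements in \<open>B\<close> colours some class has \<open>c\<close> elements, and up to
  \<open>c\<close> elements from each of the \<open>B\<close> classes still fit into
  \<open>Y\<close>; both arguments rest on the factor \<open>B\<close>.\<close>

lemma similar_colouring:
  fixes L :: "'a \<Rightarrow> nat" and Y :: "'b set"
  assumes sim: "similar (c * B) X Y" and L: "\<And>x. x \<in> X \<Longrightarrow> L x < B" and "0 < c" "0 < B"
  obtains g where "\<And>y. y \<in> Y \<Longrightarrow> g y \<in> L ` X"
    "\<And>t. similar c {x \<in> X. L x = t} {y \<in> Y. g y = t}"
proof (cases "finite X \<and> finite Y \<and> card X = card Y")
  case True
  then obtain \<beta> where \<beta>: "bij_betw \<beta> Y X" using finite_same_card_bij by metis
  show thesis
  proof
    show "L (\<beta> y) \<in> L ` X" if "y \<in> Y" for y using \<beta> that by (auto simp: bij_betw_def)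
    show "similar c {x \<in> X. L x = t} {y \<in> Y. L (\<beta> y) = t}" for t
    proof (rule similar_sym, rule similar_bij_betw)
      show "bij_betw \<beta> {y \<in> Y. L (\<beta> y) = t} {x \<in> X. L x = t}"
        using \<beta> by (auto simp: bij_betw_def inj_on_def)
    qed
  qed
next
  case False
  with sim have bX: "big (c * B) X" and bY: "big (c * B) Y" by (auto simp: similar_def)
  let ?X = "\<lambda>t. {x \<in> X. L x = t}"
  have XU: "X = (\<Union>t<B. ?X t)" using L by auto
  show thesis
  proof -
    \<comment> \<open>By the pigeonhole principle some class is past the threshold; it can absorb
      all surplus elements of \<open>Y\<close>.\<close>
    have "\<exists>t<B. big c (?X t)"
    proof (rule ccontr)
      assume "\<not> ?thesis"
      then have *: "finite (?X t)" "card (?X t) < c" if "t < B" for t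
        using that by (auto simp: big_def not_le)
      then have "finite X" using XU by (metis (no_types, lifting) finite_UN_I finite_lessThan lessThan_iff)
      moreover have "card X \<le> (\<Sum>t<B. card (?X t))"
        by (subst XU) (rule card_UN_le, simp)
      moreover have "(\<Sum>t<B. card (?X t)) < (\<Sum>t<B. c)"
        using *(2) \<open>0 < B\<close> by (intro sum_strict_mono) auto
      ultimately show False using bX by (simp add: big_def mult.commute)
    qed
    then obtain t0 where t0: "t0 < B" "big c (?X t0)" by blast
    \<comment> \<open>A class past the threshold is represented by \<open>c\<close> of its elements,
      a smaller one by all of them.\<close>
    have "\<exists>Z. Z \<subseteq> ?X t \<and> finite Z \<and> card Z \<le> c \<and> similar c (?X t) Z" for t
    proof (cases "big c (?X t)")
      case True
      then obtain Z where "Z \<subseteq> ?X t" "finite Z" "card Z = c" by (rule big_subset)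
      then show ?thesis using True by (intro exI[of _ Z]) (simp add: similar_def big_def)
    next
      case False
      then show ?thesis by (intro exI[of _ "?X t"]) (auto simp: similar_def big_def)
    qed
    then obtain Z where Z: "\<And>t. Z t \<subseteq> ?X t" "\<And>t. finite (Z t)" "\<And>t. card (Z t) \<le> c"
      "\<And>t. similar c (?X t) (Z t)" by metis
    define Z0 where "Z0 = (\<Union>t<B. Z t)"
    have "finite Z0" using Z by (simp add: Z0_def)
    have "card Z0 \<le> (\<Sum>t<B. card (Z t))" unfolding Z0_def by (rule card_UN_le) simp
    also have "\<dots> \<le> (\<Sum>t<B. c)" by (intro sum_mono Z)
    finally have "card Z0 \<le> c * B" by (simp add: mult.commute)
    with bY have "big (card Z0) Y" using big_mono by blast
    then obtain Y0 where "Y0 \<subseteq> Y" "finite Y0" "card Y0 = card Z0" by (rule big_subset)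
    then obtain \<iota> where \<iota>: "inj_on \<iota> Z0" "\<iota> ` Z0 \<subseteq> Y"
      using \<open>finite Z0\<close> finite_same_card_bij[of Z0 Y0] by (auto simp: bij_betw_def)
    \<comment> \<open>The representatives keep their colours along \<open>\<iota>\<close>; all
      remaining elements of \<open>Y\<close> get the colour \<open>t0\<close>.\<close>
    define g where "g y = (if y \<in> \<iota> ` Z0 then L (the_inv_into Z0 \<iota> y) else t0)" for y
    have g: "g (\<iota> x) = L x" if "x \<in> Z0" for x
      using that \<iota> by (simp add: g_def the_inv_into_f_f)
    have g0: "g y = t0" if "y \<notin> \<iota> ` Z0" for y
      using that by (simp add: g_def)
    have Z0X: "Z0 \<subseteq> X" using Z unfolding Z0_def by blast
    have Zt: "Z t = {x \<in> Z0. L x = t}" if "t < B" for t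
      using Z(1) that unfolding Z0_def by blast
    show thesis
    proof
      show "g y \<in> L ` X" if "y \<in> Y" for y
      proof (cases "y \<in> \<iota> ` Z0")
        case True
        then obtain x where "x \<in> Z0" "y = \<iota> x" by blast
        then show ?thesis using g Z0X by auto
      next
        case False
        have "?X t0 \<noteq> {}" using t0(2) \<open>0 < c\<close> unfolding big_def
          by (metis card.empty finite.emptyI leD)
        then show ?thesis using False g0 by auto
      qed
      show "similar c (?X t) {y \<in> Y. g y = t}" for t
      proof (cases "t < B")
        case False
        have "g y < B" for y
        proof (cases "y \<in> \<iota> ` Z0")
          case True
          then obtain x where "x \<in> Z0" "y = \<iota> x" by blast
          then show ?thesis using g Z0X L by auto
        qed (simp add: g0 t0)
        then have "{y \<in> Y. g y = t} = {}" using False by blast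
        moreover have "?X t = {}" using False L by blast
        ultimately show ?thesis by (simp only: similar_def card.empty finite.emptyI simp_thms)
      next
        case True
        have sub: "\<iota> ` Z t \<subseteq> {y \<in> Y. g y = t}"
          using Zt[OF True] \<iota>(2) g by auto
        have inj: "inj_on \<iota> (Z t)" using \<iota>(1) Zt[OF True] by (simp add: inj_on_def)
        show ?thesis
        proof (cases "t = t0")
          case t: True
          have "big c (Z t)" using Z(4)[of t] t0(2) t unfolding similar_def big_def by auto
          then have "big c (\<iota> ` Z t)" using inj Z(2) by (simp add: big_def card_image)
          then show ?thesis using t0(2) t big_mono[OF _ sub] by (auto simp: similar_def)
        next
          case t: False
          have "y \<in> \<iota> ` Z t" if "g y = t" for y
          proof -
            have "y \<in> \<iota> ` Z0" using g0 that t by auto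
            then obtain x where "x \<in> Z0" "y = \<iota> x" by blast
            then show ?thesis using that g Zt[OF True] by auto
          qed
          with sub have "{y \<in> Y. g y = t} = \<iota> ` Z t" by auto
          then show ?thesis using Z(4)[of t] inj Z(2)
            by (simp add: similar_def big_def card_image)
        qed
      qed
    qed
  qed
qed

section \<open>Products of groups and the colours of a formula\<close>

lemma tval_product_group:
  assumes "\<And>i. i \<in> I \<Longrightarrow> group (H i)" "\<And>n. a n \<in> carrier (product_group I H)" "i \<in> I"
  shows "tval (product_group I H) a t i = tval (H i) (\<lambda>n. a n i) t"
proof (induction t)
  case (TInv t)
  have "tval (product_group I H) a t \<in> carrier (product_group I H)"
    using assms by (intro tval_closed) auto
  then show ?case using TInv assms by simp
qed (use assms in auto)

lemma sat_FEq_product_group: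
  assumes "\<And>i. i \<in> I \<Longrightarrow> group (H i)" "\<And>n. a n \<in> carrier (product_group I H)"
  shows "sat (product_group I H) a (FEq s t) \<longleftrightarrow>
    (\<forall>i\<in>I. tval (H i) (\<lambda>n. a n i) s = tval (H i) (\<lambda>n. a n i) t)"
proof -
  have *: "tval (product_group I H) a t \<in> carrier (product_group I H)" for t
    using assms by (intro tval_closed) auto
  have "tval (product_group I H) a s = tval (product_group I H) a t \<longleftrightarrow>
      (\<forall>i\<in>I. tval (product_group I H) a s i = tval (product_group I H) a t i)"
    using *[of s] *[of t] by (auto intro: PiE_ext)
  then show ?thesis using assms by (simp add: tval_product_group)
qed

text \<open>\<open>col M e\<close> is a colour below \<open>B\<close> of the factor \<open>M\<close> with the components \<open>e\<close> of the environment; for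
  each colour only the number of factors up to the threshold \<open>c\<close> matters for the truth of \<open>\<phi>\<close>.\<close>

definition determines ::
    "(('a, 'b) monoid_scheme \<Rightarrow> (nat \<Rightarrow> 'a) \<Rightarrow> nat) \<Rightarrow> nat \<Rightarrow> nat \<Rightarrow> gform \<Rightarrow> bool" where
  "determines col B c \<phi> \<longleftrightarrow> 0 < c \<and> (\<forall>M e. col M e < B) \<and>
    (\<forall>(I :: nat set) H (J :: nat set) K a b.
      (\<forall>i\<in>I. group (H i)) \<longrightarrow> (\<forall>j\<in>J. group (K j)) \<longrightarrow>
      (\<forall>n. a n \<in> carrier (product_group I H)) \<longrightarrow> (\<forall>n. b n \<in> carrier (product_group J K)) \<longrightarrow>
      (\<forall>t<B. similar c {i \<in> I. col (H i) (\<lambda>n. a n i) = t} {j \<in> J. col (K j) (\<lambda>n. b n j) = t}) \<longrightarrow>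
      (sat (product_group I H) a \<phi> \<longleftrightarrow> sat (product_group J K) b \<phi>))"

lemma determinesD:
  fixes I J :: "nat set"
  assumes "determines col B c \<phi>" "\<And>i. i \<in> I \<Longrightarrow> group (H i)" "\<And>j. j \<in> J \<Longrightarrow> group (K j)"
    "\<And>n. a n \<in> carrier (product_group I H)" "\<And>n. b n \<in> carrier (product_group J K)"
    "\<And>t. t < B \<Longrightarrow> similar c {i \<in> I. col (H i) (\<lambda>n. a n i) = t} {j \<in> J. col (K j) (\<lambda>n. b n j) = t}"
  shows "sat (product_group I H) a \<phi> \<longleftrightarrow> sat (product_group J K) b \<phi>"
  using assms unfolding determines_def by blast

text \<open>Colour 0 marks the factors where the equation fails. It holds in the product iff this
  class is empty, which threshold 1 detects.\<close>

lemma determines_FEq: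
  "determines (\<lambda>M e. if tval M e s = tval M e t then 1 else 0) 2 1 (FEq s t)"
  unfolding determines_def
proof (intro conjI allI impI)
  let ?col = "\<lambda>M e. if tval M e s = tval M e t then 1 else 0 :: nat"
  fix I J :: "nat set" and H K :: "nat \<Rightarrow> ('a, 'b) monoid_scheme" and a b
  assume *: "\<forall>i\<in>I. group (H i)" "\<forall>j\<in>J. group (K j)"
    "\<forall>n. a n \<in> carrier (product_group I H)" "\<forall>n. b n \<in> carrier (product_group J K)"
    and "\<forall>t<2. similar 1 {i \<in> I. ?col (H i) (\<lambda>n. a n i) = t} {j \<in> J. ?col (K j) (\<lambda>n. b n j) = t}"
  then have "similar 1 {i \<in> I. ?col (H i) (\<lambda>n. a n i) = 0} {j \<in> J. ?col (K j) (\<lambda>n. b n j) = 0}"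
    by auto
  then have "{i \<in> I. ?col (H i) (\<lambda>n. a n i) = 0} = {} \<longleftrightarrow> {j \<in> J. ?col (K j) (\<lambda>n. b n j) = 0} = {}"
    by (rule similar_empty_iff) simp
  moreover have "sat (product_group I H) a (FEq s t) \<longleftrightarrow> {i \<in> I. ?col (H i) (\<lambda>n. a n i) = 0} = {}"
    using sat_FEq_product_group[of I H a s t] * by auto
  moreover have "sat (product_group J K) b (FEq s t) \<longleftrightarrow> {j \<in> J. ?col (K j) (\<lambda>n. b n j) = 0} = {}"
    using sat_FEq_product_group[of J K b s t] * by auto
  ultimately show "sat (product_group I H) a (FEq s t) \<longleftrightarrow> sat (product_group J K) b (FEq s t)"
    by (simp only:)
qed auto

lemma determines_FNeg: "determines col B c \<phi> \<Longrightarrow> determines col B c (FNeg \<phi>)"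
  by (simp add: determines_def)

text \<open>The pair of colours is coded as a two-digit number with lower digit in base
  \<open>B1\<close>. A class for one component is a disjoint union of classes of pairs, and
  similarity passes to such unions without loss; hence the maximum of the thresholds.\<close>

lemma determines_FConj:
  assumes \<phi>: "determines col1 B1 c1 \<phi>" and \<psi>: "determines col2 B2 c2 \<psi>"
  shows "determines (\<lambda>M e. col1 M e + B1 * col2 M e) (B1 * B2) (max c1 c2) (FConj \<phi> \<psi>)"
  unfolding determines_def
proof (intro conjI allI impI)
  let ?col = "\<lambda>M e. col1 M e + B1 * col2 M e"
  have lt: "col1 M e < B1" "col2 M e < B2" for M e
    using \<phi> \<psi> by (auto simp: determines_def)
  show "0 < max c1 c2" using \<phi> by (auto simp: determines_def)
  show ltB: "?col M e < B1 * B2" for M e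
  proof -
    have "?col M e < B1 * Suc (col2 M e)" using lt(1)[of M e] by simp
    also have "\<dots> \<le> B1 * B2" using lt(2)[of M e] by (intro mult_le_mono2) simp
    finally show ?thesis .
  qed
  fix I J :: "nat set" and H K :: "nat \<Rightarrow> ('a, 'b) monoid_scheme" and a b
  assume *: "\<forall>i\<in>I. group (H i)" "\<forall>j\<in>J. group (K j)"
    "\<forall>n. a n \<in> carrier (product_group I H)" "\<forall>n. b n \<in> carrier (product_group J K)"
    and sim: "\<forall>t<B1 * B2. similar (max c1 c2) {i \<in> I. ?col (H i) (\<lambda>n. a n i) = t}
      {j \<in> J. ?col (K j) (\<lambda>n. b n j) = t}"
  have sep: "similar c {i \<in> I. P (?col (H i) (\<lambda>n. a n i))} {j \<in> J. P (?col (K j) (\<lambda>n. b n j))}"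
    if "c \<le> max c1 c2" for P c
  proof -
    have "similar c (\<Union>t\<in>{t. t < B1 * B2 \<and> P t}. {i \<in> I. ?col (H i) (\<lambda>n. a n i) = t})
        (\<Union>t\<in>{t. t < B1 * B2 \<and> P t}. {j \<in> J. ?col (K j) (\<lambda>n. b n j) = t})"
      using sim that by (intro similar_UN) (auto simp: disjoint_family_on_def intro: similar_mono)
    moreover have "(\<Union>t\<in>{t. t < B1 * B2 \<and> P t}. {i \<in> I. ?col (H i) (\<lambda>n. a n i) = t}) =
        {i \<in> I. P (?col (H i) (\<lambda>n. a n i))}"
      "(\<Union>t\<in>{t. t < B1 * B2 \<and> P t}. {j \<in> J. ?col (K j) (\<lambda>n. b n j) = t}) =
        {j \<in> J. P (?col (K j) (\<lambda>n. b n j))}"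
      using ltB by auto
    ultimately show ?thesis by simp
  qed
  have eq: "col1 M e = ?col M e mod B1" "col2 M e = ?col M e div B1" for M e
    using lt[of M e] by auto
  have s1: "similar c1 {i \<in> I. col1 (H i) (\<lambda>n. a n i) = t} {j \<in> J. col1 (K j) (\<lambda>n. b n j) = t}" for t
    using sep[where P = "\<lambda>x. x mod B1 = t", OF max.cobounded1] by (simp only: eq(1)[symmetric])
  have s2: "similar c2 {i \<in> I. col2 (H i) (\<lambda>n. a n i) = t} {j \<in> J. col2 (K j) (\<lambda>n. b n j) = t}" for t
    using sep[where P = "\<lambda>x. x div B1 = t", OF max.cobounded2] by (simp only: eq(2)[symmetric])
  have "sat (product_group I H) a \<phi> \<longleftrightarrow> sat (product_group J K) b \<phi>"
    by (rule determinesD[OF \<phi>]) (use * s1 in auto)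
  moreover have "sat (product_group I H) a \<psi> \<longleftrightarrow> sat (product_group J K) b \<psi>"
    by (rule determinesD[OF \<psi>]) (use * s2 in auto)
  ultimately show "sat (product_group I H) a (FConj \<phi> \<psi>) \<longleftrightarrow> sat (product_group J K) b (FConj \<phi> \<psi>)"
    by simp
qed

lemma set_encode_less_power:
  assumes "X \<subseteq> {..<n}"
  shows "set_encode X < 2 ^ n"
proof -
  have "set_encode X \<le> (\<Sum>i<n. 2 ^ i)"
    unfolding set_encode_def using assms by (intro sum_mono2) auto
  also have "\<dots> < 2 ^ n" by (induction n) auto
  finally show ?thesis .
qed

text \<open>The colour for \<open>\<exists>\<close> is the set of colours that some choice of the new component attains.\<close>

lemma determines_FEx:
  assumes \<phi>: "determines col B c \<phi>"
  shows "determines (\<lambda>M e. set_encode ((\<lambda>p. col M (e(k := p))) ` carrier M)) (2 ^ B) (c * B) (FEx k \<phi>)"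
  unfolding determines_def
proof (intro conjI allI impI)
  let ?cs = "\<lambda>M e. (\<lambda>p. col M (e(k := p))) ` carrier M"
  let ?col = "\<lambda>M e. set_encode (?cs M e)"
  have ltB: "col M e < B" for M e using \<phi> by (simp add: determines_def)
  then have "0 < B" by (metis gr0I not_less0)
  have "0 < c" using \<phi> by (simp add: determines_def)
  show "0 < c * B" using \<open>0 < B\<close> \<open>0 < c\<close> by simp
  show lt: "?col M e < 2 ^ B" for M e
    by (rule set_encode_less_power) (use ltB in auto)
  \<comment> \<open>\<open>set_encode\<close> is injective on finite sets only.\<close>
  have fin: "finite (?cs M e)" for M e
    by (rule finite_subset[of _ "{..<B}"]) (use ltB in auto)
  \<comment> \<open>Stated for arbitrary families so that it yields both directions, with the two
    products exchanged.\<close>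
  have ex: "\<exists>g\<in>carrier (product_group J K). sat (product_group J K) (b(k := g)) \<phi>"
    if H: "\<forall>i\<in>I. group (H i)" and K: "\<forall>j\<in>J. group (K j)"
      and a: "\<forall>n. a n \<in> carrier (product_group I H)" and b: "\<forall>n. b n \<in> carrier (product_group J K)"
      and sim: "\<forall>t<2 ^ B. similar (c * B) {i \<in> I. ?col (H i) (\<lambda>n. a n i) = t}
        {j \<in> J. ?col (K j) (\<lambda>n. b n j) = t}"
      and f: "f \<in> carrier (product_group I H)" and sat: "sat (product_group I H) (a(k := f)) \<phi>"
    for I J :: "nat set" and H K :: "nat \<Rightarrow> ('a, 'b) monoid_scheme" and a b f
  proof -
    define X where "X t = {i \<in> I. ?col (H i) (\<lambda>n. a n i) = t}" for t
    define Y where "Y t = {j \<in> J. ?col (K j) (\<lambda>n. b n j) = t}" for t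
    define L where "L i = col (H i) ((\<lambda>n. a n i)(k := f i))" for i
    define Q where "Q t g \<longleftrightarrow> (\<forall>y\<in>Y t. g y \<in> L ` X t) \<and>
      (\<forall>r. similar c {x \<in> X t. L x = r} {y \<in> Y t. g y = r})" for t g
    \<comment> \<open>Each class of the old colouring is answered separately; inside
      \<open>X t\<close> the values of \<open>L\<close> lie in the set coded by
      \<open>t\<close>.\<close>
    have "\<exists>g. Q t g" if "t < 2 ^ B" for t
    proof (rule similar_colouring[of c B "X t" "Y t" L])
      show "similar (c * B) (X t) (Y t)" using sim that by (simp add: X_def Y_def)
    qed (use ltB \<open>0 < c\<close> \<open>0 < B\<close> in \<open>auto simp: L_def Q_def\<close>)
    then obtain G where "\<And>t. t < 2 ^ B \<Longrightarrow> Q t (G t)" by metis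
    then have G: "\<And>t y. t < 2 ^ B \<Longrightarrow> y \<in> Y t \<Longrightarrow> G t y \<in> L ` X t"
      "\<And>t r. t < 2 ^ B \<Longrightarrow> similar c {x \<in> X t. L x = r} {y \<in> Y t. G t y = r}"
      unfolding Q_def by blast+
    define G' where "G' j = G (?col (K j) (\<lambda>n. b n j)) j" for j
    have "\<exists>p. p \<in> carrier (K j) \<and> col (K j) ((\<lambda>n. b n j)(k := p)) = G' j" if "j \<in> J" for j
    proof -
      have "j \<in> Y (?col (K j) (\<lambda>n. b n j))" using that by (simp add: Y_def)
      from G(1)[OF lt this] obtain i where i: "i \<in> X (?col (K j) (\<lambda>n. b n j))" "G' j = L i"
        by (auto simp: G'_def)
      \<comment> \<open>\<open>H i\<close> and \<open>K j\<close> have the same attainable colours,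
        so the colour of \<open>f i\<close> is attained in \<open>K j\<close> as well.\<close>
      then have "?cs (H i) (\<lambda>n. a n i) = ?cs (K j) (\<lambda>n. b n j)"
        using fin by (simp add: X_def set_encode_eq)
      moreover have "L i \<in> ?cs (H i) (\<lambda>n. a n i)" using f i(1) by (auto simp: L_def X_def)
      ultimately have "L i \<in> ?cs (K j) (\<lambda>n. b n j)" by simp
      then show ?thesis using i(2) by auto
    qed
    then obtain p where p: "\<And>j. j \<in> J \<Longrightarrow> p j \<in> carrier (K j)"
      "\<And>j. j \<in> J \<Longrightarrow> col (K j) ((\<lambda>n. b n j)(k := p j)) = G' j" by metis
    let ?g = "restrict p J"
    have g: "?g \<in> carrier (product_group J K)" using p by auto
    have "sat (product_group I H) (a(k := f)) \<phi> \<longleftrightarrow> sat (product_group J K) (b(k := ?g)) \<phi>"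
    proof (rule determinesD[OF \<phi>])
      fix t
      have upd: "(\<lambda>n. (e(k := q)) n i) = (\<lambda>n. e n i)(k := q i)"
        for e :: "nat \<Rightarrow> nat \<Rightarrow> 'a" and q i by auto
      \<comment> \<open>A class of the new colouring is the disjoint union of its pieces over the
        old colours \<open>s\<close>.\<close>
      have "similar c (\<Union>s<2 ^ B. {i \<in> X s. L i = t}) (\<Union>s<2 ^ B. {j \<in> Y s. G s j = t})"
        by (rule similar_UN) (use G(2) in \<open>auto simp: disjoint_family_on_def X_def Y_def\<close>)
      moreover have "(\<Union>s<2 ^ B. {i \<in> X s. L i = t}) = {i \<in> I. col (H i) (\<lambda>n. (a(k := f)) n i) = t}"
        using lt unfolding upd by (auto simp: X_def L_def)
      moreover have "(\<Union>s<2 ^ B. {j \<in> Y s. G s j = t}) = {j \<in> J. col (K j) (\<lambda>n. (b(k := ?g)) n j) = t}"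
        using lt p(2) unfolding upd by (auto simp: Y_def G'_def)
      ultimately show "similar c {i \<in> I. col (H i) (\<lambda>n. (a(k := f)) n i) = t}
          {j \<in> J. col (K j) (\<lambda>n. (b(k := ?g)) n j) = t}" by simp
    qed (use H K a b f g in auto)
    then show ?thesis using sat g by blast
  qed
  fix I J :: "nat set" and H K :: "nat \<Rightarrow> ('a, 'b) monoid_scheme" and a b
  assume *: "\<forall>i\<in>I. group (H i)" "\<forall>j\<in>J. group (K j)"
    "\<forall>n. a n \<in> carrier (product_group I H)" "\<forall>n. b n \<in> carrier (product_group J K)"
    and sim: "\<forall>t<2 ^ B. similar (c * B) {i \<in> I. ?col (H i) (\<lambda>n. a n i) = t}
      {j \<in> J. ?col (K j) (\<lambda>n. b n j) = t}"
  then have sim': "\<forall>t<2 ^ B. similar (c * B) {j \<in> J. ?col (K j) (\<lambda>n. b n j) = t}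
      {i \<in> I. ?col (H i) (\<lambda>n. a n i) = t}"
    using similar_sym by blast
  show "sat (product_group I H) a (FEx k \<phi>) \<longleftrightarrow> sat (product_group J K) b (FEx k \<phi>)"
    unfolding sat.simps using ex[OF * sim] ex[OF *(2,1,4,3) sim'] by blast
qed

lemma ex_determines: "\<exists>col B c. determines col B c \<phi>"
proof (induction \<phi>)
  case (FEq s t)
  show ?case using determines_FEq by blast
next
  case (FNeg \<phi>)
  then show ?case using determines_FNeg by blast
next
  case (FConj \<phi> \<psi>)
  then show ?case using determines_FConj by blast
next
  case (FEx k \<phi>)
  then show ?case using determines_FEx by blast
qed

text \<open>A finite \<open>Y\<close> is exhausted at some stage. An infinite one eventually has
  \<open>c\<close> elements below \<open>s\<close>, and then both sides are big.\<close>

lemma eventually_similar: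
  fixes u :: "nat \<Rightarrow> nat"
  assumes "bij_betw u X Y"
  shows "\<exists>s0. \<forall>s\<ge>s0. similar c X {y \<in> Y. y < s}"
proof (cases "finite X")
  case True
  then have "finite Y" using assms bij_betw_finite by blast
  have "{y \<in> Y. y < s} = Y" if "Suc (Max Y) \<le> s" for s
    using that \<open>finite Y\<close> by (auto simp: Suc_le_eq intro: le_less_trans[OF Max_ge])
  then show ?thesis using similar_bij_betw[OF assms] by metis
next
  case False
  then have "infinite Y" using assms bij_betw_finite by blast
  then obtain Z where Z: "Z \<subseteq> Y" "finite Z" "card Z = c" by (metis infinite_arbitrarily_large)
  have "big c {y \<in> Y. y < s}" if "Suc (Max Z) \<le> s" for s
  proof (rule big_mono)
    show "big c Z" using Z by (simp add: big_def)
    show "Z \<subseteq> {y \<in> Y. y < s}"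
      using Z that by (auto simp: Suc_le_eq intro: le_less_trans[OF Max_ge])
  qed simp
  then show ?thesis using False by (auto simp: similar_def big_def[of c X])
qed

text \<open>Both environments are constantly the unit, so \<open>H i\<close> and
  \<open>K (u i)\<close> have equal colours. Each of the finitely many colour classes has its own
  stage, and the maximum works for all. The bijection \<open>u\<close> allows the two products to be
  indexed differently.\<close>

lemma sat_product_eventually:
  fixes H K :: "nat \<Rightarrow> ('a, 'b) monoid_scheme"
  assumes H: "\<And>i. group (H i)" and u: "bij_betw u UNIV F" and K: "\<And>i. K (u i) = H i"
    and sent: "free_vars \<phi> = {}"
  shows "\<exists>s0. \<forall>s\<ge>s0. \<phi> \<in> group_theory (product_group UNIV H) \<longleftrightarrow>
    \<phi> \<in> group_theory (product_group {n \<in> F. n < s} K)"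
proof -
  obtain col B c where \<phi>: "determines (col :: ('a, 'b) monoid_scheme \<Rightarrow> _) B c \<phi>"
    using ex_determines by blast
  let ?a = "\<lambda>n :: nat. \<one>\<^bsub>product_group UNIV H\<^esub>"
  let ?b = "\<lambda>s (n :: nat). \<one>\<^bsub>product_group {n \<in> F. n < s} K\<^esub>"
  have KF: "group (K n)" if "n \<in> F" for n
    using that u H K by (metis bij_betw_imp_surj_on image_iff)
  have a: "\<one>\<^bsub>product_group UNIV H\<^esub> \<in> carrier (product_group UNIV H)"
    using H by (metis product_group group.is_monoid monoid.one_closed)
  have gK: "group (product_group {n \<in> F. n < s} K)" for s
    using KF by (intro product_group) auto
  have b: "\<one>\<^bsub>product_group {n \<in> F. n < s} K\<^esub> \<in> carrier (product_group {n \<in> F. n < s} K)" for s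
    using gK[of s] by (metis group.is_monoid monoid.one_closed)
  define R where "R t s \<longleftrightarrow> similar c {i. col (H i) (\<lambda>n. \<one>\<^bsub>H i\<^esub>) = t}
      {n \<in> {n \<in> F. col (K n) (\<lambda>_. \<one>\<^bsub>K n\<^esub>) = t}. n < s}" for t s
  have "\<exists>s0. \<forall>s\<ge>s0. R t s" for t
    unfolding R_def
    by (rule eventually_similar[of u]) (use u K in \<open>auto simp: bij_betw_def inj_on_def image_iff\<close>)
  then obtain s0 where s0: "\<And>t s. s0 t \<le> s \<Longrightarrow> R t s" by metis
  have "\<phi> \<in> group_theory (product_group UNIV H) \<longleftrightarrow> \<phi> \<in> group_theory (product_group {n \<in> F. n < s} K)"
    if "Max (insert 0 (s0 ` {..<B})) \<le> s" for s
  proof -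
    have "sat (product_group UNIV H) ?a \<phi> \<longleftrightarrow> sat (product_group {n \<in> F. n < s} K) (?b s) \<phi>"
    proof (rule determinesD[OF \<phi>])
      fix t assume "t < B"
      then have "s0 t \<le> s" using that by auto
      then have "R t s" by (rule s0)
      moreover have "{j \<in> {n \<in> F. n < s}. col (K j) (\<lambda>n. ?b s n j) = t} =
          {n \<in> {n \<in> F. col (K n) (\<lambda>_. \<one>\<^bsub>K n\<^esub>) = t}. n < s}" by auto
      moreover have "{i \<in> UNIV. col (H i) (\<lambda>n. ?a n i) = t} = {i. col (H i) (\<lambda>n. \<one>\<^bsub>H i\<^esub>) = t}"
        by simp
      ultimately show "similar c {i \<in> UNIV. col (H i) (\<lambda>n. ?a n i) = t}
          {j \<in> {n \<in> F. n < s}. col (K j) (\<lambda>n. ?b s n j) = t}"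
        by (simp only: R_def)
    qed (use H KF a b in auto)
    then show ?thesis
      using mem_group_theory_iff[of ?a, OF a] mem_group_theory_iff[of "?b s", OF b] sent by blast
  qed
  then show ?thesis by blast
qed

section \<open>Isomorphic groups have the same theory\<close>

lemma tval_hom:
  assumes "group_hom M N f" "\<And>k. e k \<in> carrier M"
  shows "f (tval M e t) = tval N (\<lambda>k. f (e k)) t"
proof -
  interpret group_hom M N f by fact
  have "tval M e t \<in> carrier M" for t by (rule tval_closed) (use assms in auto)
  then show ?thesis by (induction t) auto
qed

lemma sat_iso:
  assumes "group M" "group N" "f \<in> iso M N" "\<And>k. e k \<in> carrier M"
  shows "sat M e \<phi> \<longleftrightarrow> sat N (\<lambda>k. f (e k)) \<phi>"
proof -
  have hom: "group_hom M N f"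
    using assms by (simp add: group_hom_def group_hom_axioms_def iso_def)
  have bij: "bij_betw f (carrier M) (carrier N)" using assms(3) by (simp add: iso_def)
  show ?thesis
    using assms(4)
  proof (induction \<phi> arbitrary: e)
    case (FEq s t)
    have "tval M e r \<in> carrier M" for r by (rule tval_closed) (use assms FEq in auto)
    then show ?case
      by (simp add: tval_hom[OF hom FEq, symmetric] inj_on_eq_iff[OF bij_betw_imp_inj_on[OF bij]])
  next
    case (FEx k \<phi>)
    have "sat M (e(k := a)) \<phi> \<longleftrightarrow> sat N ((\<lambda>k. f (e k))(k := f a)) \<phi>" if "a \<in> carrier M" for a
    proof -
      have "(\<lambda>j. f ((e(k := a)) j)) = (\<lambda>k. f (e k))(k := f a)" by auto
      moreover have "(e(k := a)) j \<in> carrier M" for j using FEx.prems that by simp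
      note FEx.IH[OF this]
      ultimately show ?thesis by (simp only:)
    qed
    moreover have "carrier N = f ` carrier M" using bij by (simp add: bij_betw_def)
    ultimately show ?case by auto
  qed auto
qed

lemma group_theory_iso:
  assumes "group M" "group N" "M \<cong> N"
  shows "group_theory M = group_theory N"
proof -
  obtain f where f: "f \<in> iso M N" using assms(3) by (auto simp: is_iso_def)
  have e: "\<one>\<^bsub>M\<^esub> \<in> carrier M" using assms(1) by (simp add: group.is_monoid)
  have "f \<one>\<^bsub>M\<^esub> \<in> carrier N" using f e by (auto simp: iso_def bij_betw_def)
  then have "\<phi> \<in> group_theory M \<longleftrightarrow> \<phi> \<in> group_theory N" for \<phi>
    using mem_group_theory_iff[of "\<lambda>_. \<one>\<^bsub>M\<^esub>" M \<phi>] mem_group_theory_iff[of "\<lambda>_. f \<one>\<^bsub>M\<^esub>" N \<phi>]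
      sat_iso[OF assms(1,2) f, of "\<lambda>_. \<one>\<^bsub>M\<^esub>" \<phi>] e by simp
  then show ?thesis by blast
qed

section \<open>Orbits\<close>

text \<open>Takes the orbit itself in place of its position in the enumeration, so that the factors
  can be indexed by least elements.\<close>

definition restriction_group :: "(nat \<Rightarrow> nat) set \<Rightarrow> nat set \<Rightarrow> (nat \<Rightarrow> nat) monoid" where
  "restriction_group G Q = (BijGroup Q)\<lparr>carrier := (\<lambda>g. restrict g Q) ` G\<rparr>"

lemma orbit_restriction_eq: "orbit_restriction G k = restriction_group G (orbit_enum G k)"
  by (simp add: orbit_restriction_def restriction_group_def Setcompr_eq_image)

locale finite_orbits =
  fixes G :: "(nat \<Rightarrow> nat) set"
  assumes subgroup: "subgroup G S_infinity" and finite_orb: "finite (orb G n)"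
begin

lemma Bij_UNIV: "Bij UNIV = {g. bij g}"
  by (auto simp: Bij_def)

lemma bij_elem: "g \<in> G \<Longrightarrow> bij g"
  using subgroup.subset[OF subgroup] by (auto simp: BijGroup_def Bij_UNIV)

lemma comp_closed: "g \<in> G \<Longrightarrow> g' \<in> G \<Longrightarrow> g \<circ> g' \<in> G"
  using subgroup.m_closed[OF subgroup, of g g'] bij_elem[of g] bij_elem[of g']
  by (simp add: BijGroup_def Bij_UNIV compose_def comp_def restrict_UNIV)

lemma id_closed: "(\<lambda>x. x) \<in> G"
  using subgroup.one_closed[OF subgroup] by (simp add: BijGroup_def restrict_UNIV)

lemma inv_closed: "g \<in> G \<Longrightarrow> inv_into UNIV g \<in> G"
  using subgroup.m_inv_closed[OF subgroup, of g] bij_elem[of g]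
  by (simp add: inv_BijGroup Bij_UNIV restrict_UNIV)

lemma orb_refl: "n \<in> orb G n"
  unfolding orb_def using id_closed by force

lemma orb_closed: "x \<in> orb G n \<Longrightarrow> g \<in> G \<Longrightarrow> g x \<in> orb G n"
  unfolding orb_def by clarify (metis comp_apply comp_closed)

lemma orb_subset: "m \<in> orb G n \<Longrightarrow> orb G m \<subseteq> orb G n"
  using orb_closed by (auto simp: orb_def[of G m])

lemma orb_sym: "m \<in> orb G n \<Longrightarrow> n \<in> orb G m"
proof -
  assume "m \<in> orb G n"
  then obtain g where g: "g \<in> G" "m = g n" by (auto simp: orb_def)
  then have "inv_into UNIV g m = n" using bij_elem by (simp add: bij_is_inj)
  then show "n \<in> orb G m" using inv_closed[OF g(1)] unfolding orb_def by blast
qed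

lemma orb_eq: "m \<in> orb G n \<Longrightarrow> orb G m = orb G n"
  using orb_subset orb_sym by (metis subset_antisym)

text \<open>The orbit is finite, and an injective self-map of a finite set is onto.\<close>

lemma restrict_Bij: "g \<in> G \<Longrightarrow> restrict g (orb G n) \<in> Bij (orb G n)"
proof -
  assume g: "g \<in> G"
  have "inj_on g (orb G n)" using bij_elem[OF g] bij_is_inj inj_on_subset subset_UNIV by blast
  moreover have "g ` orb G n \<subseteq> orb G n" using orb_closed g by auto
  ultimately have "bij_betw g (orb G n) (orb G n)"
    using finite_orb by (simp add: bij_betw_def endo_inj_surj)
  then show ?thesis by (simp add: Bij_def cong: bij_betw_cong)
qed

lemma group_as_group: "group (as_group G)"
  unfolding as_group_def using subgroup group_BijGroup by (rule subgroup.subgroup_is_group)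

text \<open>The carrier is the image of \<open>G\<close> under the restriction homomorphism into the
  symmetric group of the orbit.\<close>

lemma group_restriction_group: "group (restriction_group G (orb G n))"
proof -
  let ?Q = "orb G n"
  have mult: "g \<otimes>\<^bsub>as_group G\<^esub> g' = g \<circ> g'" if "g \<in> G" "g' \<in> G" for g g'
    using that bij_elem by (simp add: as_group_def BijGroup_def Bij_UNIV compose_def comp_def restrict_UNIV)
  have "(\<lambda>g. restrict g ?Q) \<in> hom (as_group G) (BijGroup ?Q)"
  proof (rule homI)
    show "restrict g ?Q \<in> carrier (BijGroup ?Q)" if "g \<in> carrier (as_group G)" for g
      using that restrict_Bij by (simp add: as_group_def BijGroup_def)
    show "restrict (g \<otimes>\<^bsub>as_group G\<^esub> g') ?Q = restrict g ?Q \<otimes>\<^bsub>BijGroup ?Q\<^esub> restrict g' ?Q"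
      if "g \<in> carrier (as_group G)" "g' \<in> carrier (as_group G)" for g g'
    proof -
      have gG: "g \<in> G" "g' \<in> G" using that by (auto simp: as_group_def)
      then have "restrict g ?Q \<otimes>\<^bsub>BijGroup ?Q\<^esub> restrict g' ?Q = compose ?Q (restrict g ?Q) (restrict g' ?Q)"
        by (simp add: BijGroup_def restrict_Bij)
      also have "\<dots> = restrict (g \<circ> g') ?Q"
        using gG orb_closed by (auto simp: compose_def fun_eq_iff restrict_def)
      finally show ?thesis using gG by (simp add: mult)
    qed
  qed
  then have "group_hom (as_group G) (BijGroup ?Q) (\<lambda>g. restrict g ?Q)"
    using group_as_group group_BijGroup by (simp add: group_hom_def group_hom_axioms_def)
  from group_hom.img_is_subgroup[OF this]
  have "subgroup ((\<lambda>g. restrict g ?Q) ` G) (BijGroup ?Q)" by (simp add: as_group_def)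
  then show ?thesis
    unfolding restriction_group_def using group_BijGroup by (rule subgroup.subgroup_is_group)
qed

definition orbit_rep :: "nat \<Rightarrow> nat" where
  "orbit_rep k = (case k of 0 \<Rightarrow> 0 | Suc n \<Rightarrow> LEAST x. \<forall>m\<in>{..n}. x \<notin> orbit_enum G m)"

text \<open>These are the least elements of the orbits. A test of \<open>n\<close> consults only the
  orbits of smaller numbers, so the set is decidable once orbits can be listed.\<close>

definition fresh :: "nat set" where
  "fresh = {n. \<forall>m<n. n \<notin> orb G m}"

lemma orbit_enum_eq: "orbit_enum G k = orb G (orbit_rep k)"
  by (cases k) (auto simp: orbit_rep_def)

lemma orbit_rep_Least: "orbit_rep k = (LEAST x. \<forall>m<k. x \<notin> orb G (orbit_rep m))"
proof (cases k)
  case 0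
  then show ?thesis by (auto simp: orbit_rep_def intro: Least_equality[symmetric])
next
  case (Suc n)
  have "orbit_rep k = (LEAST x. \<forall>m\<in>{..n}. x \<notin> orb G (orbit_rep m))"
    by (simp add: Suc orbit_rep_def[of "Suc n"] orbit_enum_eq)
  then show ?thesis by (simp add: Suc less_Suc_eq_le Ball_def)
qed

text \<open>Finitely many finite orbits do not exhaust the natural numbers, so the
  \<open>LEAST\<close> is attained.\<close>

lemma orbit_rep_notin: "m < k \<Longrightarrow> orbit_rep k \<notin> orb G (orbit_rep m)"
proof -
  have "finite (\<Union>m<k. orb G (orbit_rep m))" using finite_orb by simp
  then obtain x where "x \<notin> (\<Union>m<k. orb G (orbit_rep m))" using ex_new_if_finite infinite_UNIV_nat by blast
  then have "\<forall>m<k. x \<notin> orb G (orbit_rep m)" by blast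
  from LeastI[of "\<lambda>x. \<forall>m<k. x \<notin> orb G (orbit_rep m)", OF this]
  show "m < k \<Longrightarrow> orbit_rep k \<notin> orb G (orbit_rep m)" unfolding orbit_rep_Least[of k] by blast
qed

lemma less_orbit_rep: "x < orbit_rep k \<Longrightarrow> \<exists>m<k. x \<in> orb G (orbit_rep m)"
  unfolding orbit_rep_Least[of k] using not_less_Least by blast

text \<open>The representatives are unbounded, so every number lies in the orbit of one of them; and
  two least elements of the same orbit coincide.\<close>

lemma bij_betw_orbit_rep: "bij_betw orbit_rep UNIV fresh"
proof -
  have "orbit_rep j \<noteq> orbit_rep k" if "j < k" for j k
    using orbit_rep_notin[OF that] orb_refl[of "orbit_rep j"] by auto
  then have inj: "inj orbit_rep" by (rule linorder_injI)
  have fr: "orbit_rep k \<in> fresh" for k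
    unfolding fresh_def
  proof (clarify)
    fix m assume m: "m < orbit_rep k" "orbit_rep k \<in> orb G m"
    then obtain j where "j < k" "m \<in> orb G (orbit_rep j)" using less_orbit_rep by blast
    then show False using m(2) orb_eq[of m] orbit_rep_notin by auto
  qed
  have "n \<in> range orbit_rep" if n: "n \<in> fresh" for n
  proof -
    have "infinite (range orbit_rep)" using inj by (simp add: finite_image_iff)
    then obtain k where "n < orbit_rep k" unfolding infinite_nat_iff_unbounded by blast
    then obtain j where j: "n \<in> orb G (orbit_rep j)" using less_orbit_rep by blast
    then have "orbit_rep j \<in> orb G n" by (rule orb_sym)
    then have "\<not> orbit_rep j < n" "\<not> n < orbit_rep j"
      using n fr[of j] j by (auto simp: fresh_def)
    then show ?thesis by (metis linorder_neqE_nat rangeI)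
  qed
  then show ?thesis using inj fr by (auto simp: bij_betw_def)
qed

text \<open>Orbit independence provides an abstract isomorphism, which is enough since it preserves
  the theory.\<close>

lemma theory_eventually:
  assumes "orbit_independent G" "free_vars \<phi> = {}"
  shows "\<exists>s0. \<forall>s\<ge>s0. \<phi> \<in> group_theory (as_group G) \<longleftrightarrow>
    \<phi> \<in> group_theory (product_group {n \<in> fresh. n < s} (\<lambda>n. restriction_group G (orb G n)))"
proof -
  have gr: "group (orbit_restriction G k)" for k
    using group_restriction_group by (simp add: orbit_restriction_eq orbit_enum_eq)
  have "group_theory (as_group G) = group_theory (product_group UNIV (orbit_restriction G))"
    using assms(1) group_as_group gr unfolding orbit_independent_def
    by (intro group_theory_iso product_group) auto
  then show ?thesis
    using sat_product_eventually[of "orbit_restriction G" orbit_rep fresh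
        "\<lambda>n. restriction_group G (orb G n)", OF gr bij_betw_orbit_rep _ assms(2)]
    by (simp add: orbit_restriction_eq orbit_enum_eq)
qed

section \<open>Levels of the tree\<close>

lemma perm_string_Suc:
  "perm_string g (Suc n) = perm_string g n @ [g (Suc n), inv_into UNIV g (Suc n)]"
  by (simp add: perm_string_def)

lemma length_perm_string [simp]: "length (perm_string g n) = 2 * Suc n"
  by (induction n) (auto simp: perm_string_Suc, simp add: perm_string_def)

lemma perm_string_nth: "i \<le> n \<Longrightarrow> perm_string g n ! (2 * i) = g i"
proof (induction n)
  case 0
  then show ?case by (simp add: perm_string_def)
next
  case (Suc n)
  then show ?case by (cases "i = Suc n") (auto simp: perm_string_Suc nth_append)
qed

text \<open>\<open>hd\<close> of \<open>drop\<close> is the form in which list access occurs in the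
  computable functions below.\<close>

lemma hd_drop_perm_string: "i \<le> n \<Longrightarrow> hd (drop (2 * i) (perm_string g n)) = g i"
  by (simp add: hd_drop_conv_nth perm_string_nth)

lemma prefix_perm_string: "n \<le> m \<Longrightarrow> prefix (perm_string g n) (perm_string g m)"
proof (induction m rule: dec_induct)
  case (step m)
  then show ?case by (auto simp: perm_string_Suc)
qed simp

definition level :: "nat \<Rightarrow> nat list set" where
  "level n = (\<lambda>g. perm_string g n) ` G"

lemma perm_tree_iff: "\<sigma> \<in> perm_tree G \<longleftrightarrow> (\<exists>n. \<sigma> \<in> level n)"
  by (auto simp: perm_tree_def level_def)

lemma level_iff: "\<sigma> \<in> level n \<longleftrightarrow> \<sigma> \<in> perm_tree G \<and> length \<sigma> = 2 * Suc n"
  by (auto simp: perm_tree_def level_def)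

text \<open>Every nonempty initial part of even length of a tree string is again in the tree, and
  odd lengths do not occur; so an immediate successor adds exactly one pair.\<close>

lemma immediate_succs_level:
  assumes "\<sigma> \<in> level n"
  shows "immediate_succs (perm_tree G) \<sigma> = {\<sigma> @ [x, y] | x y. \<sigma> @ [x, y] \<in> perm_tree G}"
proof (intro equalityI subsetI)
  fix \<tau> assume \<tau>: "\<tau> \<in> immediate_succs (perm_tree G) \<sigma>"
  then obtain g m where g: "g \<in> G" "\<tau> = perm_string g m"
    by (auto simp: immediate_succs_def perm_tree_def)
  have pre: "strict_prefix \<sigma> \<tau>" using \<tau> by (simp add: immediate_succs_def)
  have len: "length \<sigma> = 2 * Suc n" using assms by (simp add: level_iff)
  have "n < m" using prefix_length_less[OF pre] len g by simp
  then have "prefix (perm_string g n) \<tau>" using g prefix_perm_string by simp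
  \<comment> \<open>Two prefixes of \<open>\<tau>\<close> of equal length coincide.\<close>
  then have \<sigma>: "\<sigma> = perm_string g n"
    using pre len by (metis length_perm_string not_equal_is_parallel parallel_def
        prefix_same_cases strict_prefix_def)
  let ?\<rho> = "perm_string g (Suc n)"
  have "?\<rho> \<in> perm_tree G" using g by (auto simp: perm_tree_def)
  moreover have "strict_prefix \<sigma> ?\<rho>" "prefix ?\<rho> \<tau>"
    using g \<open>n < m\<close> prefix_perm_string[of "Suc n" m g]
    by (auto simp: \<sigma> perm_string_Suc strict_prefix_def)
  ultimately have "\<tau> = ?\<rho>" using \<tau> by (auto simp: immediate_succs_def strict_prefix_def)
  then show "\<tau> \<in> {\<sigma> @ [x, y] | x y. \<sigma> @ [x, y] \<in> perm_tree G}"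
    using \<open>?\<rho> \<in> perm_tree G\<close> by (auto simp: \<sigma> perm_string_Suc)
next
  fix \<tau> assume "\<tau> \<in> {\<sigma> @ [x, y] | x y. \<sigma> @ [x, y] \<in> perm_tree G}"
  then obtain x y where \<tau>: "\<tau> = \<sigma> @ [x, y]" "\<tau> \<in> perm_tree G" by auto
  have "\<not> (strict_prefix \<sigma> \<rho> \<and> strict_prefix \<rho> \<tau>)" if "\<rho> \<in> perm_tree G" for \<rho>
  proof
    assume "strict_prefix \<sigma> \<rho> \<and> strict_prefix \<rho> \<tau>"
    then have "length \<rho> = Suc (2 * Suc n)"
      using assms prefix_length_less[of \<sigma> \<rho>] prefix_length_less[of \<rho> \<tau>] by (auto simp: level_iff \<tau>(1))
    moreover have "even (length \<rho>)" using that by (auto simp: perm_tree_def)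
    ultimately show False by simp
  qed
  then show "\<tau> \<in> immediate_succs (perm_tree G) \<sigma>"
    using \<tau> by (auto simp: immediate_succs_def strict_prefix_def)
qed

text \<open>The new entries are the values at \<open>Suc n\<close> of \<open>g\<close> and of its
  inverse, which is also in \<open>G\<close>; both lie in one finite orbit.\<close>

lemma finite_immediate_succs:
  assumes "\<sigma> \<in> level n"
  shows "finite (immediate_succs (perm_tree G) \<sigma>)"
proof (rule finite_subset)
  show "immediate_succs (perm_tree G) \<sigma> \<subseteq>
      (\<lambda>(x, y). \<sigma> @ [x, y]) ` (orb G (Suc n) \<times> orb G (Suc n))"
  proof
    fix \<tau> assume "\<tau> \<in> immediate_succs (perm_tree G) \<sigma>"
    then obtain x y where \<tau>: "\<tau> = \<sigma> @ [x, y]" "\<tau> \<in> perm_tree G"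
      using immediate_succs_level[OF assms] by auto
    then have "\<tau> \<in> level (Suc n)" using assms by (simp add: level_iff)
    then obtain g where g: "g \<in> G" "\<tau> = perm_string g (Suc n)" by (auto simp: level_def)
    then have "x = g (Suc n)" "y = inv_into UNIV g (Suc n)" using \<tau>(1) by (auto simp: perm_string_Suc)
    then have "x \<in> orb G (Suc n)" "y \<in> orb G (Suc n)" using g(1) inv_closed by (auto simp: orb_def)
    then show "\<tau> \<in> (\<lambda>(x, y). \<sigma> @ [x, y]) ` (orb G (Suc n) \<times> orb G (Suc n))" using \<tau> by auto
  qed
qed (use finite_orb in auto)

lemma finite_level_0: "finite (level 0)"
proof (rule finite_subset)
  show "level 0 \<subseteq> (\<lambda>(x, y). [x, y]) ` (orb G 0 \<times> orb G 0)"
    using inv_closed by (force simp: level_def perm_string_def orb_def)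
qed (use finite_orb in auto)

lemma level_Suc: "level (Suc n) = (\<Union>\<sigma>\<in>level n. immediate_succs (perm_tree G) \<sigma>)"
proof (intro equalityI subsetI)
  fix \<tau> assume \<tau>: "\<tau> \<in> level (Suc n)"
  then obtain g where g: "g \<in> G" "\<tau> = perm_string g (Suc n)" by (auto simp: level_def)
  then have "perm_string g n \<in> level n" by (auto simp: level_def)
  moreover have "\<tau> \<in> immediate_succs (perm_tree G) (perm_string g n)"
    using \<tau> g unfolding immediate_succs_level[OF calculation] by (auto simp: level_iff perm_string_Suc)
  ultimately show "\<tau> \<in> (\<Union>\<sigma>\<in>level n. immediate_succs (perm_tree G) \<sigma>)" by blast
next
  fix \<tau> assume "\<tau> \<in> (\<Union>\<sigma>\<in>level n. immediate_succs (perm_tree G) \<sigma>)"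
  then obtain \<sigma> where \<sigma>: "\<sigma> \<in> level n" "\<tau> \<in> immediate_succs (perm_tree G) \<sigma>" by blast
  then show "\<tau> \<in> level (Suc n)" unfolding immediate_succs_level[OF \<sigma>(1)] by (auto simp: level_iff)
qed

section \<open>Listing successors and levels with the branching function\<close>

definition candidates :: "nat list \<Rightarrow> nat \<Rightarrow> nat list list" where
  "candidates \<sigma> k = filter (\<lambda>\<tau>. \<tau> \<in> perm_tree G)
     (map (\<lambda>c. \<sigma> @ [fst (prod_decode c), snd (prod_decode c)]) [0..<k])"

text \<open>The branching number tells when all successors have been found. The disjunct for strings
  outside the tree makes the search stop for every string, as a total search requires.\<close>

definition succ_list :: "nat list \<Rightarrow> nat list list" where
  "succ_list \<sigma> = candidates \<sigma>
     (LEAST k. \<sigma> \<notin> perm_tree G \<or> length (candidates \<sigma> k) = branching_fun (perm_tree G) (list_encode \<sigma>))"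

lemma candidates_subset:
  assumes "\<sigma> \<in> level n"
  shows "set (candidates \<sigma> k) \<subseteq> immediate_succs (perm_tree G) \<sigma>"
  unfolding immediate_succs_level[OF assms] by (auto simp: candidates_def)

lemma inj_append_pair: "inj_on (\<lambda>c. \<sigma> @ [fst (prod_decode c), snd (prod_decode c)]) A"
proof (rule inj_onI)
  fix c d assume "\<sigma> @ [fst (prod_decode c), snd (prod_decode c)] =
    \<sigma> @ [fst (prod_decode d), snd (prod_decode d)]"
  then have "prod_decode c = prod_decode d" by (simp add: prod_eq_iff)
  then show "c = d" by (metis prod_decode_inverse)
qed

lemma distinct_candidates: "distinct (candidates \<sigma> k)"
  unfolding candidates_def by (simp add: distinct_map inj_append_pair)

lemma candidates_complete:
  "\<exists>k. \<sigma> \<notin> perm_tree G \<or> length (candidates \<sigma> k) = branching_fun (perm_tree G) (list_encode \<sigma>)"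
proof (cases "\<sigma> \<in> perm_tree G")
  case True
  then obtain n where n: "\<sigma> \<in> level n" by (auto simp: perm_tree_iff)
  let ?S = "immediate_succs (perm_tree G) \<sigma>"
  let ?C = "{c. \<sigma> @ [fst (prod_decode c), snd (prod_decode c)] \<in> ?S}"
  have "finite ?C"
    by (rule inj_on_finite[OF inj_append_pair _ finite_immediate_succs[OF n]]) auto
  then obtain k where k: "\<And>c. c \<in> ?C \<Longrightarrow> c < k" unfolding finite_nat_set_iff_bounded by blast
  have "?S \<subseteq> set (candidates \<sigma> k)"
  proof
    fix \<tau> assume \<tau>: "\<tau> \<in> ?S"
    then obtain x y where "\<tau> = \<sigma> @ [x, y]" "\<tau> \<in> perm_tree G"
      using immediate_succs_level[OF n] by auto
    moreover from this have "prod_encode (x, y) < k" using \<tau> by (intro k) simp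
    ultimately show "\<tau> \<in> set (candidates \<sigma> k)"
      by (auto simp: candidates_def image_iff intro!: bexI[of _ "prod_encode (x, y)"])
  qed
  then have "set (candidates \<sigma> k) = ?S" using candidates_subset[OF n] by blast
  then have "length (candidates \<sigma> k) = card ?S" by (metis distinct_candidates distinct_card)
  then show ?thesis using True by (auto simp: branching_fun_def)
qed auto

text \<open>A repetition-free list of successors whose length is the number of successors omits
  none.\<close>

lemma set_succ_list:
  assumes "\<sigma> \<in> level n"
  shows "set (succ_list \<sigma>) = immediate_succs (perm_tree G) \<sigma>"
proof -
  have T: "\<sigma> \<in> perm_tree G" using assms by (auto simp: perm_tree_iff)
  have "length (succ_list \<sigma>) = card (immediate_succs (perm_tree G) \<sigma>)"
    using LeastI_ex[OF candidates_complete[of \<sigma>]] T by (simp add: succ_list_def branching_fun_def)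
  then have "card (set (succ_list \<sigma>)) = card (immediate_succs (perm_tree G) \<sigma>)"
    by (metis distinct_candidates distinct_card succ_list_def)
  then show ?thesis
    using candidates_subset[OF assms] finite_immediate_succs[OF assms]
    by (metis card_subset_eq succ_list_def)
qed

text \<open>The empty string is not in the tree, so the branching function gives no access to level
  0. That level is finite and enters as a fixed constant, which is computable however it was
  chosen.\<close>

definition level_list :: "nat \<Rightarrow> nat list list" where
  "level_list n = rec_nat (SOME l. set l = level 0) (\<lambda>_ L. concat (map succ_list L)) n"

lemma set_level_list: "set (level_list n) = level n"
proof (induction n)
  case 0
  have "\<exists>l. set l = level 0" using finite_level_0 finite_list by blast
  from someI_ex[OF this] show ?case by (simp add: level_list_def)
next
  case (Suc n)
  then show ?case by (simp add: level_list_def level_Suc set_succ_list)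
qed

end

section \<open>Finite subproducts as coded groups\<close>

text \<open>Distinctness of \<open>ns\<close> lets a list be read back as a function on the indices;
  the lists \<open>L n\<close> may contain repetitions.\<close>

lemma image_PiE_product_lists:
  assumes "distinct ns" and L: "\<And>n. n \<in> set ns \<Longrightarrow> set (L n) = f n ` A n"
  shows "(\<lambda>x. map (\<lambda>n. f n (x n)) ns) ` (\<Pi>\<^sub>E n\<in>set ns. A n) = set (product_lists (map L ns))"
proof (intro equalityI subsetI)
  fix xs assume "xs \<in> (\<lambda>x. map (\<lambda>n. f n (x n)) ns) ` (\<Pi>\<^sub>E n\<in>set ns. A n)"
  then obtain x where x: "x \<in> (\<Pi>\<^sub>E n\<in>set ns. A n)" "xs = map (\<lambda>n. f n (x n)) ns" by blast
  have "f n (x n) \<in> set (L n)" if "n \<in> set ns" for n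
    using L[OF that] x(1) that by auto
  then show "xs \<in> set (product_lists (map L ns))"
    by (auto simp: product_lists_set x(2) list_all2_conv_all_nth)
next
  fix xs assume "xs \<in> set (product_lists (map L ns))"
  then have len: "length xs = length ns" and xs: "\<And>i. i < length ns \<Longrightarrow> xs ! i \<in> set (L (ns ! i))"
    by (auto simp: product_lists_set list_all2_conv_all_nth)
  define v where "v n = the (map_of (zip ns xs) n)" for n
  have v: "v (ns ! i) = xs ! i" if "i < length ns" for i
    using map_of_zip_nth[OF len[symmetric] assms(1)] that len by (simp add: v_def)
  have "\<exists>a. a \<in> A n \<and> f n a = v n" if n: "n \<in> set ns" for n
  proof -
    obtain i where i: "i < length ns" "n = ns ! i" using n by (metis in_set_conv_nth)
    then have "v n \<in> f n ` A n" using xs[OF i(1)] v[OF i(1)] L[OF that] by simp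
    then show ?thesis by auto
  qed
  then obtain a where a: "\<And>n. n \<in> set ns \<Longrightarrow> a n \<in> A n" "\<And>n. n \<in> set ns \<Longrightarrow> f n (a n) = v n" by metis
  have "xs = map (\<lambda>n. f n (restrict a (set ns) n)) ns"
    by (rule nth_equalityI) (use len a(2) v in auto)
  moreover have "restrict a (set ns) \<in> (\<Pi>\<^sub>E n\<in>set ns. A n)" using a(1) by auto
  ultimately show "xs \<in> (\<lambda>x. map (\<lambda>n. f n (x n)) ns) ` (\<Pi>\<^sub>E n\<in>set ns. A n)" by blast
qed

definition table_mult :: "nat list \<Rightarrow> nat list \<Rightarrow> nat list" where
  "table_mult p q = map (\<lambda>i. hd (drop i p)) q"

definition tuple_mult :: "nat list list \<Rightarrow> nat list list \<Rightarrow> nat list list" where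
  "tuple_mult p q = map (\<lambda>i. table_mult (hd (drop i p)) (hd (drop i q))) [0..<length p]"

lemma tuple_mult_map: "tuple_mult (map f ns) (map g ns) = map (\<lambda>n. table_mult (f n) (g n)) ns"
  by (rule nth_equalityI) (auto simp: tuple_mult_def hd_drop_conv_nth)

context finite_orbits
begin

text \<open>Level \<open>n\<close> is the first whose strings record a value at \<open>n\<close>, at
  position \<open>n + n\<close>.\<close>

definition orbit_list :: "nat \<Rightarrow> nat list" where
  "orbit_list n = map (\<lambda>\<sigma>. hd (drop (n + n) \<sigma>)) (level_list n)"

definition orbit_bound :: "nat \<Rightarrow> nat" where
  "orbit_bound n = Suc (sum_list (orbit_list n))"

text \<open>Points off the orbit are fixed, so that tables of one length compose by lookup and the
  unit is \<open>[0..<orbit_bound n]\<close>.\<close>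

definition table :: "nat \<Rightarrow> (nat \<Rightarrow> nat) \<Rightarrow> nat list" where
  "table n f = map (\<lambda>i. if i \<in> set (orbit_list n) then f i else i) [0..<orbit_bound n]"

text \<open>The orbit of \<open>n\<close> may contain numbers above \<open>n\<close>, at which
  strings of level \<open>n\<close> give no values. Strings of level \<open>orbit_bound n\<close>
  cover the whole orbit.\<close>

definition table_list :: "nat \<Rightarrow> nat list list" where
  "table_list n = map (\<lambda>\<sigma>. map (\<lambda>i. if i \<in> set (orbit_list n) then hd (drop (i + i) \<sigma>) else i)
     [0..<orbit_bound n]) (level_list (orbit_bound n))"

definition fresh_list :: "nat \<Rightarrow> nat list" where
  "fresh_list s = filter (\<lambda>n. \<forall>m\<in>set [0..<n]. n \<notin> set (orbit_list m)) [0..<s]"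

definition tuple_list :: "nat \<Rightarrow> nat list list list" where
  "tuple_list s = product_lists (map table_list (fresh_list s))"

definition tuple_one :: "nat \<Rightarrow> nat list list" where
  "tuple_one s = map (\<lambda>n. [0..<orbit_bound n]) (fresh_list s)"

lemma set_orbit_list: "set (orbit_list n) = orb G n"
  using hd_drop_perm_string[of n n]
  by (auto simp: orbit_list_def set_level_list level_def orb_def mult_2 image_image)

lemma orb_less_bound: "i \<in> orb G n \<Longrightarrow> i < orbit_bound n"
  using member_le_sum_list[of i "orbit_list n"] by (simp add: orbit_bound_def set_orbit_list less_Suc_eq_le)

lemma nth_table: "i < orbit_bound n \<Longrightarrow> table n f ! i = (if i \<in> orb G n then f i else i)"
  by (simp add: table_def set_orbit_list)

lemma length_table [simp]: "length (table n f) = orbit_bound n"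
  by (simp add: table_def)

lemma set_fresh_list: "set (fresh_list s) = {n \<in> fresh. n < s}"
  by (auto simp: fresh_list_def fresh_def set_orbit_list)

lemma set_table_list: "set (table_list n) = table n ` carrier (restriction_group G (orb G n))"
proof -
  have "map (\<lambda>i. if i \<in> set (orbit_list n) then hd (drop (i + i) (perm_string g (orbit_bound n))) else i)
      [0..<orbit_bound n] = table n (restrict g (orb G n))" for g
    using hd_drop_perm_string[of _ "orbit_bound n" g]
    by (auto simp: table_def set_orbit_list mult_2)
  then show ?thesis
    by (auto simp: table_list_def set_level_list level_def restriction_group_def image_image)
qed

text \<open>The orbit is closed under \<open>g\<close> and all other points are fixed, so a lookup
  never leaves the table.\<close>

lemma table_mult_table:
  assumes f: "f \<in> carrier (restriction_group G (orb G n))"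
    and g: "g \<in> carrier (restriction_group G (orb G n))"
  shows "table_mult (table n f) (table n g) = table n (f \<otimes>\<^bsub>restriction_group G (orb G n)\<^esub> g)"
proof -
  have Bij: "f \<in> Bij (orb G n)" "g \<in> Bij (orb G n)"
    using f g restrict_Bij by (auto simp: restriction_group_def)
  then have mult: "f \<otimes>\<^bsub>restriction_group G (orb G n)\<^esub> g = compose (orb G n) f g"
    by (simp add: restriction_group_def BijGroup_def)
  have closed: "g i \<in> orb G n" if "i \<in> orb G n" for i
    using Bij_imp_funcset[OF Bij(2)] that by auto
  show ?thesis
    unfolding mult
  proof (rule nth_equalityI)
    fix i assume "i < length (table_mult (table n f) (table n g))"
    then have i: "i < orbit_bound n" by (simp add: table_mult_def)
    then have lt: "table n g ! i < orbit_bound n"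
      using closed orb_less_bound by (simp add: nth_table)
    have "table_mult (table n f) (table n g) ! i = table n f ! (table n g ! i)"
      using i lt by (simp add: table_mult_def hd_drop_conv_nth)
    also have "\<dots> = table n (compose (orb G n) f g) ! i"
      using lt i closed by (auto simp: nth_table compose_def)
    finally show "table_mult (table n f) (table n g) ! i = table n (compose (orb G n) f g) ! i" .
  qed (simp add: table_mult_def)
qed

text \<open>Restrictions are extensional, hence determined by their values on the orbit, and the
  table records all of these.\<close>

lemma inj_on_table: "inj_on (table n) (carrier (restriction_group G (orb G n)))"
proof (rule inj_onI)
  fix f g assume fg: "f \<in> carrier (restriction_group G (orb G n))"
    "g \<in> carrier (restriction_group G (orb G n))" and eq: "table n f = table n g"
  have "f i = g i" if "i \<in> orb G n" for i
    using nth_table[OF orb_less_bound[OF that], of f] nth_table[OF orb_less_bound[OF that], of g]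
      that eq by simp
  moreover have "f \<in> extensional (orb G n)" "g \<in> extensional (orb G n)"
    using fg by (auto simp: restriction_group_def)
  ultimately show "f = g" by (metis extensionalityI)
qed

lemma finite_group_code_product:
  "finite_group_code (product_group {n \<in> fresh. n < s} (\<lambda>n. restriction_group G (orb G n)))
     tuple_mult (tuple_list s) (tuple_one s) (\<lambda>x. map (\<lambda>n. table n (x n)) (fresh_list s))"
proof -
  let ?F = "{n \<in> fresh. n < s}" and ?K = "\<lambda>n. restriction_group G (orb G n)"
  let ?P = "product_group ?F ?K"
  let ?\<rho> = "\<lambda>x. map (\<lambda>n. table n (x n)) (fresh_list s)"
  have set: "set (fresh_list s) = ?F" by (rule set_fresh_list)
  have dist: "distinct (fresh_list s)" by (simp add: fresh_list_def)
  interpret group ?P by (rule product_group) (rule group_restriction_group)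
  show ?thesis
  proof unfold_locales
    show "inj_on ?\<rho> (carrier ?P)"
    proof (rule inj_onI)
      fix x y assume xy: "x \<in> carrier ?P" "y \<in> carrier ?P" and eq: "?\<rho> x = ?\<rho> y"
      have "x n = y n" if "n \<in> ?F" for n
      proof (rule inj_onD[OF inj_on_table[of n]])
        show "table n (x n) = table n (y n)" using eq that set by simp
        show "x n \<in> carrier (?K n)" "y n \<in> carrier (?K n)" using xy that by auto
      qed
      then show "x = y" using xy unfolding carrier_product_group by (rule PiE_ext[rotated 2])
    qed
    show "?\<rho> ` carrier ?P = set (tuple_list s)"
      using image_PiE_product_lists[OF dist, of table_list table "\<lambda>n. carrier (?K n)"]
      by (simp add: set tuple_list_def set_table_list)
    show "?\<rho> (x \<otimes>\<^bsub>?P\<^esub> y) = tuple_mult (?\<rho> x) (?\<rho> y)" if "x \<in> carrier ?P" "y \<in> carrier ?P" for x y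
      unfolding tuple_mult_map
    proof (rule map_cong[OF refl])
      fix n assume "n \<in> set (fresh_list s)"
      then have n: "n \<in> ?F" using set by simp
      then have "x n \<in> carrier (?K n)" "y n \<in> carrier (?K n)" using that by auto
      then show "table n ((x \<otimes>\<^bsub>?P\<^esub> y) n) = table_mult (table n (x n)) (table n (y n))"
        using n by (simp add: table_mult_table)
    qed
    show "?\<rho> \<one>\<^bsub>?P\<^esub> = tuple_one s"
      unfolding tuple_one_def
    proof (rule map_cong[OF refl])
      fix n assume "n \<in> set (fresh_list s)"
      then have "n \<in> ?F" using set by simp
      then show "table n (\<one>\<^bsub>?P\<^esub> n) = [0..<orbit_bound n]"
        by (auto simp: table_def set_orbit_list restriction_group_def BijGroup_def intro: map_idI)
    qed
  qed
qed

text \<open>The oracle is consulted only in listing successors: membership filters the candidates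
  and the branching number ends the search. All else is list processing.\<close>

lemma computable_tuples:
  assumes T: "decides h (\<lambda>\<sigma> :: nat list. \<sigma> \<in> perm_tree G)"
    and br: "computable h (branching_fun (perm_tree G))"
  shows "computable h tuple_list" "computable h tuple_one"
proof -
  have enc: "list_encode \<sigma> = enc \<sigma>" for \<sigma> :: "nat list"
    by (simp add: enc_list_def enc_nat_def[abs_def])
  have cand: "computable h (\<lambda>p. candidates (fst p) (snd p))"
    unfolding candidates_def by (intro computable_intros decides_comp[OF T])
  have P: "decides h (\<lambda>p. fst p \<notin> perm_tree G \<or>
      length (candidates (fst p) (snd p)) = branching_fun (perm_tree G) (list_encode (fst p)))"
    unfolding enc
    by (intro computable_intros decides_comp[OF T] computable_comp[OF br] computable_comp2[OF cand])
  have succ: "computable h succ_list"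
    unfolding succ_list_def[abs_def]
    by (intro computable_comp2[OF cand] computable_Least[OF P candidates_complete] computable_intros)
  have lev: "computable h level_list"
    unfolding level_list_def[abs_def] by (intro computable_intros computable_comp[OF succ])
  have orb: "computable h orbit_list"
    unfolding orbit_list_def[abs_def] by (intro computable_intros computable_comp[OF lev])
  have bound: "computable h orbit_bound"
    unfolding orbit_bound_def[abs_def] by (intro computable_intros computable_comp[OF orb])
  have tab: "computable h table_list"
    unfolding table_list_def[abs_def]
    by (intro computable_intros computable_comp[OF orb] computable_comp[OF lev] computable_comp[OF bound])
  have fresh: "computable h fresh_list"
    unfolding fresh_list_def[abs_def] by (intro computable_intros computable_comp[OF orb])
  show "computable h tuple_list"
    unfolding tuple_list_def[abs_def]
    by (intro computable_intros computable_comp[OF tab] computable_comp[OF fresh])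
  show "computable h tuple_one"
    unfolding tuple_one_def[abs_def]
    by (intro computable_intros computable_comp[OF bound] computable_comp[OF fresh])
qed

end

lemma computable_tuple_mult: "computable h (\<lambda>p. tuple_mult (fst p) (snd p))"
  unfolding tuple_mult_def table_mult_def by (intro computable_intros)

section \<open>The degree of the tree\<close>

lemma turing_le_trans: "turing_le f g \<Longrightarrow> turing_le g h \<Longrightarrow> turing_le f h"
  unfolding turing_le_def[of f] by (rule recursive_in_trans)

lemma turing_le_iff_computable: "turing_le f h \<longleftrightarrow> computable h f"
  by (simp add: turing_le_def computable_def enc_nat_def)

lemma turing_le_join_fun: "turing_le f (join_fun f g)" "turing_le g (join_fun f g)"
proof -
  have join: "computable (join_fun f g) (join_fun f g)"
    unfolding turing_le_iff_computable[symmetric] turing_le_def by (rule recursive_in.orac)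
  have "computable (join_fun f g) (\<lambda>n. join_fun f g (n + n))"
    by (intro computable_comp[OF join] computable_intros)
  then show "turing_le f (join_fun f g)"
    unfolding turing_le_iff_computable by (simp add: join_fun_def flip: mult_2)
  have "computable (join_fun f g) (\<lambda>n. join_fun f g (Suc (n + n)))"
    by (intro computable_comp[OF join] computable_intros)
  then show "turing_le g (join_fun f g)"
    unfolding turing_le_iff_computable by (simp add: join_fun_def flip: mult_2)
qed

text \<open>\<open>degree_join\<close> ranges over representatives \<open>f\<close> and
  \<open>g\<close> of the two degrees, so the reduction passes through their join and from there to
  the tree and its branching function.\<close>

lemma tree_degreeD:
  assumes "h \<in> tree_degree T"
  shows "decides h (\<lambda>\<sigma> :: nat list. \<sigma> \<in> T)" "computable h (branching_fun T)"
proof -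
  obtain f g where f: "turing_le (char_fun (list_encode ` T)) f" and g: "turing_le (branching_fun T) g"
    and h: "turing_le (join_fun f g) h"
    using assms by (auto simp: tree_degree_def degree_join_def turing_degree_def)
  have "turing_le (char_fun (list_encode ` T)) h" "turing_le (branching_fun T) h"
    using f g h turing_le_join_fun turing_le_trans by blast+
  then have c: "computable h (char_fun (list_encode ` T))" and "computable h (branching_fun T)"
    by (auto simp: turing_le_iff_computable)
  then show "computable h (branching_fun T)" by simp
  have "char_fun (list_encode ` T) (enc \<sigma>) = (if \<sigma> \<in> T then 1 else 0)" for \<sigma> :: "nat list"
    by (simp add: char_fun_def enc_list_def enc_nat_def[abs_def] inj_image_mem_iff[OF inj_list_encode])
  then show "decides h (\<lambda>\<sigma> :: nat list. \<sigma> \<in> T)"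
    unfolding decides_def using computable_comp[OF c computable_enc[where ?'a = "nat list"]] by simp
qed

text \<open>The easy half of the limit lemma.\<close>

lemma Delta02_in_limit:
  fixes D :: "nat \<Rightarrow> nat \<Rightarrow> bool"
  assumes D: "decides h (\<lambda>p. D (fst p) (snd p))"
    and lim: "\<And>n. \<exists>s0. \<forall>s\<ge>s0. n \<in> A \<longleftrightarrow> D n s"
  shows "Delta02_in h A"
proof -
  let ?R = "\<lambda>xs :: nat list. D (xs ! 0) (xs ! 1 + xs ! 2)"
  have "recursive_in h 3
     (\<lambda>xs. (\<lambda>c. enc ((\<lambda>p. if D (fst p) (snd p) then 1 else 0 :: nat) (dec c)))
        (prod_encode (xs ! 0, xs ! 1 + xs ! 2)))"
    by (rule recursive_in_comp1, use D in \<open>simp add: computable_def decides_def\<close>)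
      (intro recursive_in_prod_encode recursive_in_add recursive_in.proj; simp)
  then have R: "decidable_in h 3 ?R"
    by (simp add: decidable_in_def dec_prod enc_nat_def)
  have "n \<in> A \<longleftrightarrow> (\<exists>x. \<forall>y. ?R [n, x, y])" "n \<in> A \<longleftrightarrow> (\<forall>x. \<exists>y. ?R [n, x, y])" for n
  proof -
    obtain s0 where s0: "\<And>s. s \<ge> s0 \<Longrightarrow> n \<in> A \<longleftrightarrow> D n s" using lim[of n] by blast
    have "n \<in> A \<longleftrightarrow> (\<exists>x. \<forall>y. D n (x + y))"
      using s0 by (metis le_add1 le_add2)
    then show "n \<in> A \<longleftrightarrow> (\<exists>x. \<forall>y. ?R [n, x, y])" by simp
    have "n \<in> A \<longleftrightarrow> (\<forall>x. \<exists>y. D n (x + y))"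
      using s0 by (metis le_add1 le_add2)
    then show "n \<in> A \<longleftrightarrow> (\<forall>x. \<exists>y. ?R [n, x, y])" by simp
  qed
  then show ?thesis
    unfolding Delta02_in_def Sigma02_in_def Pi02_in_def using R by blast
qed

section \<open>Injectivity of the coding of formulas\<close>

lemma tcode_inject: "tcode s = tcode t \<Longrightarrow> s = t"
proof (induction s arbitrary: t)
  case (TVar n)
  then show ?case by (cases t) auto
next
  case TOne
  then show ?case by (cases t) auto
next
  case (TMult s1 s2)
  then show ?case by (cases t) auto
next
  case (TInv s)
  then show ?case by (cases t) auto
qed

lemma inj_fcode: "inj fcode"
proof (rule injI)
  show "\<phi> = \<psi>" if "fcode \<phi> = fcode \<psi>" for \<phi> \<psi>
    using that
  proof (induction \<phi> arbitrary: \<psi>)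
    case (FEq s t)
    then show ?case by (cases \<psi>) (auto dest: tcode_inject)
  next
    case (FNeg \<phi>)
    then show ?case by (cases \<psi>) auto
  next
    case (FConj \<phi>1 \<phi>2)
    then show ?case by (cases \<psi>) auto
  next
    case (FEx k \<phi>)
    then show ?case by (cases \<psi>) auto
  qed
qed

theorem theorem4:
  fixes G :: "(nat \<Rightarrow> nat) set"
  assumes "profinite_subgroup G"
    and "orbit_independent G"
  shows "Delta02_rel_degree (tree_degree (perm_tree G)) (fcode ` group_theory (as_group G))"
  unfolding Delta02_rel_degree_def
proof
  fix h assume h: "h \<in> tree_degree (perm_tree G)"
  interpret finite_orbits G
    using assms(1) by (simp add: finite_orbits_def profinite_subgroup_def)
  let ?P = "\<lambda>s. product_group {n \<in> fresh. n < s} (\<lambda>n. restriction_group G (orb G n))"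
  let ?D = "\<lambda>n s. feval tuple_mult (tuple_list s) (tuple_one s) n [] = Some 1"
  have D: "n \<in> fcode ` group_theory (?P s) \<longleftrightarrow> ?D n s" for n s
    by (rule finite_group_code.mem_theory_iff_feval[OF finite_group_code_product])
  have feval: "computable h (\<lambda>x. feval tuple_mult (tuple_list (fst x)) (tuple_one (fst x))
      (fst (snd x)) (snd (snd x)))"
    by (intro computable_feval computable_tuple_mult computable_tuples tree_degreeD[OF h])
  show "Delta02_in h (fcode ` group_theory (as_group G))"
  proof (rule Delta02_in_limit)
    have "computable h (\<lambda>p. feval tuple_mult (tuple_list (snd p)) (tuple_one (snd p)) (fst p) [])"
      using computable_comp[OF feval, of "\<lambda>p. (snd p, fst p, [])"] by (simp add: computable_intros)
    then show "decides h (\<lambda>p. ?D (fst p) (snd p))"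
      by (intro decides_eq computable_const)
  next
    fix n
    show "\<exists>s0. \<forall>s\<ge>s0. n \<in> fcode ` group_theory (as_group G) \<longleftrightarrow> ?D n s"
    proof (cases "\<exists>\<phi>. n = fcode \<phi> \<and> free_vars \<phi> = {}")
      \<comment> \<open>A number that does not code a sentence belongs to none of the theories, so
        both sides are false at every stage.\<close>
      case False
      then have "n \<notin> fcode ` group_theory (as_group G)" "n \<notin> fcode ` group_theory (?P s)" for s
        unfolding group_theory_def sentence_def by blast+
      then show ?thesis unfolding D[symmetric] by blast
    next
      case True
      then obtain \<phi> where \<phi>: "n = fcode \<phi>" "free_vars \<phi> = {}" by blast
      from theory_eventually[OF assms(2) \<phi>(2)] show ?thesis
        unfolding D[symmetric] \<phi>(1) inj_image_mem_iff[OF inj_fcode] .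
    qed
  qed
qed

end
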